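(* Every half-integral zonotope of dimension at least $1$ has expansion at least $7/12$.
   Context: A zonotope is a Minkowski sum of finitely many line segments in $\mathbb{R}^d$ (for some $d$). A polytope (in particular a zonotope) in $\mathbb{R}^d$ is called half-integral if all its vertices belong to $\{0,1/2,1\}^d$. The graph of a polytope $P$ is the graph formed by the vertices and the edges (one-dimensional faces) of $P$. The expansion (edge expansion, Cheeger constant) of a finite graph $G$ with vertex set $V$ is $$h(G)=\min\left\{\frac{|\partial S|}{\min\{|S|,|V\setminus S|\}} : S\subset V,\ S\neq\emptyset,\ S\neq V\right\},$$ where $\partial S$ is the set of the edges of $G$ with one vertex in $S$ and the other in $V\setminus S$. The expansion of a polytope is the expansion of its graph. *)

theory Defs
  imports "HOL-Analysis.Analysis"
begin

text \<open>The sum below is the Minkowski sum of sets. Degenerate segments are allowed,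
  so single points count as zonotopes (of dimension 0).\<close>

definition zonotope :: "'a::euclidean_space set \<Rightarrow> bool" where
  "zonotope Z \<longleftrightarrow>
     (\<exists>(m::nat) (a :: nat \<Rightarrow> 'a) (b :: nat \<Rightarrow> 'a). Z = (\<Sum>i<m. closed_segment (a i) (b i)))"

definition vertices :: "'a::real_vector set \<Rightarrow> 'a set" where
  "vertices P = {x. x extreme_point_of P}"

definition half_integral :: "(real ^ 'n) set \<Rightarrow> bool" where
  "half_integral P \<longleftrightarrow> (\<forall>v \<in> vertices P. \<forall>i. v $ i \<in> {0, 1/2, 1})"

text \<open>A graph is given by a vertex set and a set of unordered pairs of vertices.
  An edge (one-dimensional face) of a polytope is a segment, and it is represented in the
  graph of the polytope by the set of its two endpoints.\<close>

definition graph_edges :: "'a::euclidean_space set \<Rightarrow> 'a set set" where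
  "graph_edges P = vertices ` {e. e edge_of P}"

definition edge_boundary :: "'v set \<Rightarrow> 'v set set \<Rightarrow> 'v set \<Rightarrow> 'v set set" where
  "edge_boundary V E S = {e \<in> E. \<exists>u \<in> S. \<exists>v \<in> V - S. e = {u, v}}"

text \<open>Meaningful for a finite graph with at least two vertices: otherwise \<open>Min\<close> is applied
  to an empty or possibly infinite set.\<close>

definition graph_expansion :: "'v set \<Rightarrow> 'v set set \<Rightarrow> real" where
  "graph_expansion V E =
     Min {real (card (edge_boundary V E S)) / real (min (card S) (card (V - S))) | S.
          S \<subseteq> V \<and> S \<noteq> {} \<and> S \<noteq> V}"

definition polytope_expansion :: "'a::euclidean_space set \<Rightarrow> real" where
  "polytope_expansion P = graph_expansion (vertices P) (graph_edges P)"

end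

theory Submission
  imports Defs
begin

text \<open>
  The proof replaces the expansion of a graph with vertex set \<open>V\<close> by the stronger inequality
  \<open>|\<partial>S| \<ge> c |S| log\<^sub>2 (|V| / |S|)\<close> for all \<open>S \<subseteq> V\<close>, called \<open>log_isoperimetric\<close> below. For sets
  of size at most \<open>|V| / 2\<close> the logarithm is at least 1, so the inequality implies expansion at
  least \<open>c\<close>. Unlike expansion, it passes to box products with the same constant: this is the
  subadditivity of entropy \<open>H(X|Y) + H(Y|X) \<le> H(X, Y)\<close> for a uniformly random element of \<open>S\<close>.

  It therefore suffices to write the graph of the zonotope as a box product of graphs that satisfy
  the inequality with \<open>c = 7/12\<close>. Merge parallel segments, so that the zonotope is \<open>p\<close> plus the sum
  of the segments \<open>[0, g]\<close> over a finite set \<open>G\<close> of pairwise non-parallel vectors. Each \<open>g\<close> is the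
  difference of the endpoints of an edge, hence has coordinates in \<open>{0, \<plusminus>1/2, \<plusminus>1}\<close>. The width of the
  zonotope in the direction of a coordinate is the sum of the absolute values of that coordinate
  over \<open>G\<close>, and is at most 1. So every coordinate is nonzero either on at most one generator or on
  exactly two of them, with values \<open>\<plusminus>1/2\<close>. Read as an equation for a linear dependency \<open>\<mu>\<close> of \<open>G\<close>, such
  a coordinate says \<open>\<mu> g = 0\<close> or \<open>\<mu> g = \<plusminus>\<mu> h\<close>. Consequently \<open>G\<close> splits into generators on which all
  dependencies vanish and into disjoint blocks, each carrying one dependency up to scaling, with
  all coefficients \<open>\<plusminus>1\<close>; a block has at least three elements, since there are no parallel vectors.

  The vertices of the zonotope are the points \<open>p + \<Sum>x\<close> for those \<open>x \<subseteq> G\<close> for which some linear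
  functional is positive on \<open>x\<close> and negative on \<open>G - x\<close>. By Gordan's theorem such a functional exists unless
  some nonzero dependency is nonnegative on \<open>x\<close> and nonpositive on \<open>G - x\<close>. So the only condition on
  \<open>x\<close> is that its trace on each block \<open>B\<close> is neither the positive nor the negative part of the
  dependency of \<open>B\<close>. Adding one generator to such an \<open>x\<close>, if the result is again of this kind, gives
  an edge. The graph thus contains a box product of edges and of cubes with two antipodal vertices
  (\<^emph>\<open>poles\<close>) removed, of dimensions \<open>k \<ge> 3\<close>.

  For the cube the inequality holds with \<open>c = 1\<close>, by the product theorem. For the punctured cube of
  dimension \<open>k \<ge> 4\<close> it follows with \<open>c = 2/3\<close> by putting each pole on the side that contains most of
  its neighbours. For \<open>k = 3\<close> the graph is a hexagon, whose nontrivial cuts have at least two edges.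
\<close>

section \<open>Logarithmic isoperimetric inequalities\<close>

text \<open>Boundary edges are oriented, from \<open>S\<close> to its complement, so that for a symmetric relation \<open>E\<close>
  each of them counts once.\<close>
definition boundary :: "'v rel \<Rightarrow> 'v set \<Rightarrow> 'v set \<Rightarrow> 'v rel" where
  "boundary E V S = {(u, v) \<in> E. u \<in> S \<and> v \<in> V - S}"

definition log_isoperimetric :: "real \<Rightarrow> 'v set \<Rightarrow> 'v rel \<Rightarrow> bool" where
  "log_isoperimetric c V E \<longleftrightarrow>
     (\<forall>S \<subseteq> V. c * (card S * log 2 (card V / card S)) \<le> card (boundary E V S))"

lemma log_isoperimetricI:
  assumes "\<And>S. S \<subseteq> V \<Longrightarrow> S \<noteq> {} \<Longrightarrow> S \<noteq> V \<Longrightarrow>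
             c * (card S * log 2 (card V / card S)) \<le> card (boundary E V S)"
  shows "log_isoperimetric c V E"
  unfolding log_isoperimetric_def
proof (intro allI impI)
  fix S assume "S \<subseteq> V"
  then show "c * (card S * log 2 (card V / card S)) \<le> card (boundary E V S)"
    using assms[of S] by (cases "S = {} \<or> S = V") auto
qed

lemma log_isoperimetricD:
  "log_isoperimetric c V E \<Longrightarrow> S \<subseteq> V \<Longrightarrow>
     c * (card S * log 2 (card V / card S)) \<le> card (boundary E V S)"
  by (simp add: log_isoperimetric_def)

lemma finite_boundary: "finite V \<Longrightarrow> S \<subseteq> V \<Longrightarrow> finite (boundary E V S)"
  by (rule finite_subset[of _ "V \<times> V"]) (auto simp: boundary_def)

lemma log_isoperimetric_mono:
  assumes "log_isoperimetric c V E" "c' \<le> c" "finite V"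
  shows "log_isoperimetric c' V E"
proof (rule log_isoperimetricI)
  fix S assume S: "S \<subseteq> V" "S \<noteq> {}"
  have "0 < card S" "card S \<le> card V"
    using S assms(3) by (auto simp: card_gt_0_iff finite_subset card_mono)
  then have "0 \<le> card S * log 2 (card V / card S)"
    by (intro mult_nonneg_nonneg zero_le_log_cancel_iff[THEN iffD2]) (auto simp: field_simps)
  with assms(2) have "c' * (card S * log 2 (card V / card S)) \<le> c * (card S * log 2 (card V / card S))"
    by (intro mult_right_mono) auto
  with log_isoperimetricD[OF assms(1) S(1)]
  show "c' * (card S * log 2 (card V / card S)) \<le> card (boundary E V S)" by linarith
qed

text \<open>The target may have more edges than the source: additional edges only enlarge boundaries.\<close>
lemma log_isoperimetric_transport:
  assumes iso: "log_isoperimetric c V E" and f: "bij_betw f V W" and fin: "finite V"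
    and hom: "\<And>u v. u \<in> V \<Longrightarrow> v \<in> V \<Longrightarrow> (u, v) \<in> E \<Longrightarrow> (f u, f v) \<in> F"
  shows "log_isoperimetric c W F"
proof (rule log_isoperimetricI)
  fix T assume T: "T \<subseteq> W"
  define S where "S = {v \<in> V. f v \<in> T}"
  have inj: "inj_on f V" and img: "f ` V = W" using f by (auto simp: bij_betw_def)
  have "f ` S = T" using T img by (auto simp: S_def)
  moreover have inj': "inj_on f S" using inj by (rule inj_on_subset) (auto simp: S_def)
  ultimately have cS: "card S = card T" using card_image by fastforce
  have cV: "card W = card V" using f by (simp add: bij_betw_same_card)
  have "map_prod f f ` boundary E V S \<subseteq> boundary F W T"
    using hom img by (auto simp: boundary_def S_def)
  moreover have "finite W" using fin img by auto
  ultimately have "card (map_prod f f ` boundary E V S) \<le> card (boundary F W T)"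
    using T by (intro card_mono finite_boundary)
  moreover have "card (map_prod f f ` boundary E V S) = card (boundary E V S)"
    using inj by (intro card_image) (auto simp: inj_on_def boundary_def S_def)
  moreover have "c * (card S * log 2 (card V / card S)) \<le> card (boundary E V S)"
    using iso by (rule log_isoperimetricD) (auto simp: S_def)
  ultimately show "c * (card T * log 2 (card W / card T)) \<le> card (boundary F W T)"
    by (simp add: cS cV)
qed

definition box_product :: "'v rel \<Rightarrow> 'w rel \<Rightarrow> ('v \<times> 'w) rel" where
  "box_product E F = {((x, y), (x', y')). (x, x') \<in> E \<and> y = y' \<or> x = x' \<and> (y, y') \<in> F}"

lemma log2_le: "0 < x \<Longrightarrow> log 2 x \<le> (x - 1) / ln 2" for x :: real
  unfolding log_def using ln_le_minus_one[of x] by (intro divide_right_mono) auto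

text \<open>This is \<open>H(X|Y) + H(Y|X) \<le> H(X, Y)\<close> for a uniformly distributed pair \<open>(X, Y) \<in> S\<close>. After the
  right-hand side is moved to the left, \<open>log t \<le> (t - 1) / ln 2\<close> bounds every summand, and it remains to
  compare a sum over \<open>S\<close> with the same sum over a product set containing \<open>S\<close>, which factors into
  \<open>|S| * |S|\<close>.\<close>
lemma sum_log_fibres_le:
  fixes S :: "('v \<times> 'w) set"
  assumes S: "finite S"
  defines "r \<equiv> \<lambda>x. {y. (x, y) \<in> S}" and "q \<equiv> \<lambda>y. {x. (x, y) \<in> S}"
  shows "(\<Sum>(x, y)\<in>S. log 2 (card (r x)) + log 2 (card (q y))) \<le> card S * log 2 (card S)"
proof -
  have fr: "finite (r x)" for x
    using finite_imageI[OF S, of snd] by (rule finite_subset[rotated]) (force simp: r_def)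
  have fq: "finite (q y)" for y
    using finite_imageI[OF S, of fst] by (rule finite_subset[rotated]) (force simp: q_def)
  have sr: "(\<Sum>x\<in>fst ` S. card (r x)) = card S"
  proof -
    have "S = (SIGMA x:fst ` S. r x)" by (force simp: r_def)
    then have "card S = card (SIGMA x:fst ` S. r x)" by simp
    also have "\<dots> = (\<Sum>x\<in>fst ` S. card (r x))"
      using S fr by (intro card_SigmaI) auto
    finally show ?thesis by simp
  qed
  have sq: "(\<Sum>y\<in>snd ` S. card (q y)) = card S"
  proof -
    have "prod.swap ` S = (SIGMA y:snd ` S. q y)" by (force simp: q_def)
    then have "card (prod.swap ` S) = (\<Sum>y\<in>snd ` S. card (q y))"
      using S fq by (simp add: card_SigmaI)
    moreover have "card (prod.swap ` S) = card S" by (intro card_image) auto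
    ultimately show ?thesis by simp
  qed
  have pos: "0 < card (r x)" "0 < card (q y)" "0 < card S" if "(x, y) \<in> S" for x y
    using that fr fq S by (auto simp: card_gt_0_iff r_def q_def)
  have "(\<Sum>(x, y)\<in>S. log 2 (card (r x)) + log 2 (card (q y))) - card S * log 2 (card S)
      = (\<Sum>p\<in>S. (case p of (x, y) \<Rightarrow> log 2 (card (r x)) + log 2 (card (q y))) - log 2 (card S))"
    by (simp add: sum_subtractf)
  also have "\<dots> = (\<Sum>(x, y)\<in>S. log 2 (card (r x) * card (q y) / card S))"
  proof (intro sum.cong refl, clarify)
    fix x y assume "(x, y) \<in> S"
    then show "log 2 (card (r x)) + log 2 (card (q y)) - log 2 (card S)
        = log 2 (card (r x) * card (q y) / card S)"
      using pos by (simp add: log_mult_pos log_divide_pos)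
  qed
  also have "\<dots> \<le> (\<Sum>(x, y)\<in>S. (card (r x) * card (q y) / card S - 1) / ln 2)"
    using pos by (intro sum_mono) (auto intro!: log2_le)
  also have "\<dots> = ((\<Sum>(x, y)\<in>S. card (r x) * card (q y)) / card S - card S) / ln 2"
    by (simp add: case_prod_unfold sum_subtractf sum_divide_distrib[symmetric])
  also have "\<dots> \<le> 0"
  proof -
    have "(\<Sum>(x, y)\<in>S. card (r x) * card (q y)) \<le> (\<Sum>(x, y)\<in>fst ` S \<times> snd ` S. card (r x) * card (q y))"
      using S by (intro sum_mono2) force+
    also have "\<dots> = card S * card S"
      by (simp add: sum.cartesian_product[symmetric] sum_product[symmetric] sr sq)
    finally have "real (\<Sum>(x, y)\<in>S. card (r x) * card (q y)) \<le> real (card S * card S)"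
      using of_nat_le_iff by blast
    then show ?thesis
      by (cases "card S = 0") (auto simp: field_simps)
  qed
  finally show ?thesis by simp
qed

text \<open>The boundary of \<open>S\<close> consists of the boundaries of all its fibres in both directions. Summing the
  hypotheses over the fibres produces \<open>|S| (log |V| + log |W|)\<close> minus the sum that
  \<open>sum_log_fibres_le\<close> bounds by \<open>|S| log |S|\<close>.\<close>
lemma log_isoperimetric_box_product:
  assumes V: "log_isoperimetric c V E" "finite V" and W: "log_isoperimetric c W F" "finite W"
    and c: "c \<ge> 0" and irr: "irrefl E" "irrefl F"
  shows "log_isoperimetric c (V \<times> W) (box_product E F)"
proof (rule log_isoperimetricI)
  fix S assume S: "S \<subseteq> V \<times> W" and "S \<noteq> {}" "S \<noteq> V \<times> W"
  define r where "r x = {y. (x, y) \<in> S}" for x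
  define q where "q y = {x. (x, y) \<in> S}" for y
  have fS: "finite S" using V(2) W(2) by (intro finite_subset[OF S] finite_cartesian_product)
  have rW: "r x \<subseteq> W" and qV: "q y \<subseteq> V" for x y using S by (auto simp: r_def q_def)
  have fr: "finite (r x)" and fq: "finite (q y)" for x y
    using finite_subset[OF rW W(2)] finite_subset[OF qV V(2)] .
  let ?A = "\<lambda>x. (\<lambda>(y, y'). ((x, y), (x, y'))) ` boundary F W (r x)"
  let ?B = "\<lambda>y. (\<lambda>(x, x'). ((x, y), (x', y))) ` boundary E V (q y)"
  have sub: "(\<Union>x\<in>V. ?A x) \<union> (\<Union>y\<in>W. ?B y) \<subseteq> boundary (box_product E F) (V \<times> W) S"
    by (auto simp: boundary_def box_product_def r_def q_def)
  have fA: "finite (?A x)" and fB: "finite (?B y)" for x y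
    using finite_boundary[OF W(2) rW] finite_boundary[OF V(2) qV] by auto
  have cA: "card (?A x) = card (boundary F W (r x))" and cB: "card (?B y) = card (boundary E V (q y))" for x y
    by (intro card_image, force simp: inj_on_def)+
  have "card (\<Union>x\<in>V. ?A x) = (\<Sum>x\<in>V. card (boundary F W (r x)))"
    using V fA by (subst card_UN_disjoint) (auto simp: cA)
  moreover have "card (\<Union>y\<in>W. ?B y) = (\<Sum>y\<in>W. card (boundary E V (q y)))"
    using W fB by (subst card_UN_disjoint) (auto simp: cB)
  moreover have "(\<Union>x\<in>V. ?A x) \<inter> (\<Union>y\<in>W. ?B y) = {}"
    using irr by (auto simp: boundary_def irrefl_def)
  ultimately have "(\<Sum>x\<in>V. card (boundary F W (r x))) + (\<Sum>y\<in>W. card (boundary E V (q y)))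
      = card ((\<Union>x\<in>V. ?A x) \<union> (\<Union>y\<in>W. ?B y))"
    using V W fA fB by (subst card_Un_disjoint) auto
  also have "\<dots> \<le> card (boundary (box_product E F) (V \<times> W) S)"
    using sub V W S by (intro card_mono finite_boundary) auto
  finally have lower: "(\<Sum>x\<in>V. real (card (boundary F W (r x)))) + (\<Sum>y\<in>W. real (card (boundary E V (q y))))
      \<le> card (boundary (box_product E F) (V \<times> W) S)"
    by (simp only: of_nat_sum[symmetric] of_nat_add[symmetric] of_nat_le_iff)
  have pos: "0 < card (r x)" "0 < card (q y)" "0 < card S" "0 < card V" "0 < card W" if "(x, y) \<in> S" for x y
    using that fr fq fS S V W by (auto simp: card_gt_0_iff r_def q_def)
  have R: "(\<Sum>(x, y)\<in>S. log 2 (card W / card (r x))) = (\<Sum>x\<in>V. card (r x) * log 2 (card W / card (r x)))"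
  proof -
    have "S = (SIGMA x:V. r x)" using S by (auto simp: r_def)
    then have "(\<Sum>(x, y)\<in>S. log 2 (card W / card (r x))) = (\<Sum>(x, y)\<in>(SIGMA x:V. r x). log 2 (card W / card (r x)))"
      by simp
    also have "\<dots> = (\<Sum>x\<in>V. \<Sum>y\<in>r x. log 2 (card W / card (r x)))"
      using V fr by (subst sum.Sigma) auto
    finally show ?thesis by simp
  qed
  have Q: "(\<Sum>(x, y)\<in>S. log 2 (card V / card (q y))) = (\<Sum>y\<in>W. card (q y) * log 2 (card V / card (q y)))"
  proof -
    have "prod.swap ` S = (SIGMA y:W. q y)" using S by (force simp: q_def)
    then have "(\<Sum>(y, x)\<in>(SIGMA y:W. q y). log 2 (card V / card (q y)))
        = (\<Sum>(y, x)\<in>prod.swap ` S. log 2 (card V / card (q y)))" by simp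
    also have "\<dots> = (\<Sum>(x, y)\<in>S. log 2 (card V / card (q y)))"
      by (subst sum.reindex) (auto simp: case_prod_unfold)
    also have "(\<Sum>(y, x)\<in>(SIGMA y:W. q y). log 2 (card V / card (q y)))
        = (\<Sum>y\<in>W. \<Sum>x\<in>q y. log 2 (card V / card (q y)))"
      using W fq by (subst sum.Sigma) auto
    finally show ?thesis by simp
  qed
  have "card S * log 2 (card (V \<times> W) / card S)
      \<le> (\<Sum>(x, y)\<in>S. log 2 (card W) + log 2 (card V))
         - (\<Sum>(x, y)\<in>S. log 2 (card (r x)) + log 2 (card (q y)))"
  proof -
    obtain x y where xy: "(x, y) \<in> S" using \<open>S \<noteq> {}\<close> by auto
    have "card S * log 2 (card (V \<times> W) / card S)
      = card S * (log 2 (card W) + log 2 (card V)) - card S * log 2 (card S)"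
      using pos[OF xy] by (simp add: log_divide_pos log_mult_pos card_cartesian_product algebra_simps)
    moreover have "(\<Sum>(x, y)\<in>S. log 2 (card W) + log 2 (card V)) = card S * (log 2 (card W) + log 2 (card V))"
      by (simp add: case_prod_unfold)
    ultimately show ?thesis
      using sum_log_fibres_le[OF fS] by (simp add: r_def q_def)
  qed
  also have "\<dots> = (\<Sum>(x, y)\<in>S. log 2 (card W / card (r x))) + (\<Sum>(x, y)\<in>S. log 2 (card V / card (q y)))"
    unfolding sum_subtractf[symmetric] sum.distrib[symmetric]
    using pos by (intro sum.cong refl) (clarsimp simp: log_divide_pos)
  finally have "c * (card S * log 2 (card (V \<times> W) / card S))
     \<le> c * ((\<Sum>x\<in>V. card (r x) * log 2 (card W / card (r x))) + (\<Sum>y\<in>W. card (q y) * log 2 (card V / card (q y))))"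
    unfolding R Q using c by (rule mult_left_mono)
  also have "\<dots> = (\<Sum>x\<in>V. c * (card (r x) * log 2 (card W / card (r x))))
      + (\<Sum>y\<in>W. c * (card (q y) * log 2 (card V / card (q y))))"
    by (simp add: sum_distrib_left distrib_left)
  also have "\<dots> \<le> (\<Sum>x\<in>V. real (card (boundary F W (r x)))) + (\<Sum>y\<in>W. real (card (boundary E V (q y))))"
    by (intro add_mono sum_mono log_isoperimetricD V W rW qV)
  finally show "c * (card S * log 2 (card (V \<times> W) / card S)) \<le> card (boundary (box_product E F) (V \<times> W) S)"
    using lower by linarith
qed

lemma boundary_le_edge_boundary:
  assumes "finite V" "S \<subseteq> V"
  shows "card (boundary {(u, v). {u, v} \<in> E} V S) \<le> card (edge_boundary V E S)"
proof (rule card_inj_on_le)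
  show "inj_on (\<lambda>(u, v). {u, v}) (boundary {(u, v). {u, v} \<in> E} V S)"
    by (auto simp: inj_on_def boundary_def doubleton_eq_iff)
  show "(\<lambda>(u, v). {u, v}) ` boundary {(u, v). {u, v} \<in> E} V S \<subseteq> edge_boundary V E S"
    by (auto simp: boundary_def edge_boundary_def)
  show "finite (edge_boundary V E S)"
    by (rule finite_subset[of _ "Pow V"]) (use assms in \<open>auto simp: edge_boundary_def\<close>)
qed

lemma edge_boundary_complement:
  "S \<subseteq> V \<Longrightarrow> edge_boundary V E (V - S) = edge_boundary V E S"
  by (auto simp: edge_boundary_def)

text \<open>A set and its complement have the same boundary, so the minimum in the denominator may be taken
  to be \<open>|S|\<close>, in which case \<open>log 2 (|V| / |S|) \<ge> 1\<close>.\<close>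
lemma log_isoperimetric_imp_expansion:
  assumes iso: "log_isoperimetric c V {(u, v). {u, v} \<in> E}" and c: "0 \<le> c"
    and V: "finite V" "2 \<le> card V"
  shows "c \<le> graph_expansion V E"
proof -
  have half: "c * card S \<le> card (edge_boundary V E S)"
    if S: "S \<subseteq> V" "S \<noteq> {}" "card S \<le> card (V - S)" for S
  proof -
    have pos: "0 < card S" using S V finite_subset by (auto simp: card_gt_0_iff)
    have "card V = card S + card (V - S)" using S V by (metis card_Diff_subset card_mono finite_subset le_add_diff_inverse)
    then have "2 \<le> real (card V) / card S" using pos S by (simp add: field_simps)
    then have "1 \<le> log 2 (card V / card S)" by (subst one_le_log_cancel_iff) auto
    then have "c * card S * 1 \<le> c * card S * log 2 (card V / card S)" using c by (intro mult_left_mono) auto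
    also have "\<dots> \<le> card (boundary {(u, v). {u, v} \<in> E} V S)"
      using log_isoperimetricD[OF iso S(1)] by (simp add: mult.assoc)
    also have "\<dots> \<le> card (edge_boundary V E S)" using boundary_le_edge_boundary[OF V(1) S(1)] by simp
    finally show ?thesis by simp
  qed
  have ratio: "c \<le> card (edge_boundary V E S) / min (card S) (card (V - S))"
    if S: "S \<subseteq> V" "S \<noteq> {}" "S \<noteq> V" for S
  proof -
    have pos: "0 < card S" "0 < card (V - S)"
      using S V finite_subset by (auto simp: card_gt_0_iff)
    show ?thesis
    proof (cases "card S \<le> card (V - S)")
      case True
      then show ?thesis using half[of S] S pos by (simp add: field_simps min_def)
    next
      case False
      moreover have "V - (V - S) = S" using S by blast
      ultimately show ?thesis
        using half[of "V - S"] S pos by (simp add: edge_boundary_complement field_simps min_def)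
    qed
  qed
  let ?R = "{real (card (edge_boundary V E S)) / real (min (card S) (card (V - S))) | S.
    S \<subseteq> V \<and> S \<noteq> {} \<and> S \<noteq> V}"
  have "finite ?R" using V(1) by simp
  moreover obtain v where "v \<in> V" using V by fastforce
  then have "{v} \<subseteq> V" "{v} \<noteq> {}" "{v} \<noteq> V" using V by auto
  then have "?R \<noteq> {}" by blast
  ultimately show ?thesis
    unfolding graph_expansion_def using ratio by (subst Min_ge_iff) blast+
qed

section \<open>Cubes and their products, as graphs on set families\<close>

text \<open>The adjacency relation of the cube, without reference to a ground set.\<close>
definition flip :: "'a set rel" where
  "flip = {(x, y). \<exists>g. sym_diff x y = {g}}"

lemma irrefl_flip: "irrefl flip"
  by (auto simp: irrefl_def flip_def)

lemma flip_commute: "(x, y) \<in> flip \<longleftrightarrow> (y, x) \<in> flip"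
  by (simp add: flip_def Un_commute)

lemma flip_cases:
  assumes "(x, y) \<in> flip"
  obtains g where "g \<notin> x" "y = insert g x" | g where "g \<notin> y" "x = insert g y"
proof -
  obtain g where "sym_diff x y = {g}" using assms by (auto simp: flip_def)
  then have iff: "h \<in> sym_diff x y \<longleftrightarrow> h = g" for h by simp
  show thesis
  proof (cases "g \<in> x")
    case True
    have "h \<in> x \<longleftrightarrow> h \<in> insert g y" for h using iff[of h] True by auto
    moreover have "g \<notin> y" using iff[of g] True by auto
    ultimately show thesis using that(2) by blast
  next
    case False
    have "h \<in> y \<longleftrightarrow> h \<in> insert g x" for h using iff[of h] iff[of g] False by auto
    with False show thesis using that(1) by blast
  qed
qed

text \<open>On disjoint ground sets \<open>(x, y) \<mapsto> x \<union> y\<close> identifies the box product with a family of sets, and a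
  flip in one factor becomes a flip of the union.\<close>
lemma log_isoperimetric_join:
  assumes X: "log_isoperimetric c X flip" "finite X" "X \<subseteq> Pow A"
    and Y: "log_isoperimetric c Y flip" "finite Y" "Y \<subseteq> Pow B"
    and AB: "A \<inter> B = {}" and c: "c \<ge> 0"
  shows "log_isoperimetric c ((\<lambda>(x, y). x \<union> y) ` (X \<times> Y)) flip"
proof (rule log_isoperimetric_transport)
  show "log_isoperimetric c (X \<times> Y) (box_product flip flip)"
    using X Y c by (intro log_isoperimetric_box_product irrefl_flip)
  show "bij_betw (\<lambda>(x, y). x \<union> y) (X \<times> Y) ((\<lambda>(x, y). x \<union> y) ` (X \<times> Y))"
  proof (intro inj_on_imp_bij_betw inj_onI, clarify)
    fix x y x' y' assume "x \<in> X" "y \<in> Y" "x' \<in> X" "y' \<in> Y" and eq: "x \<union> y = x' \<union> y'"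
    then have "x \<subseteq> A" "x' \<subseteq> A" "y \<subseteq> B" "y' \<subseteq> B" using X(3) Y(3) by auto
    with eq AB show "x = x' \<and> y = y'" by blast
  qed
  show "finite (X \<times> Y)" using X Y by simp
next
  fix u v assume u: "u \<in> X \<times> Y" and v: "v \<in> X \<times> Y" and "(u, v) \<in> box_product flip flip"
  then consider x x' y where "u = (x, y)" "v = (x', y)" "(x, x') \<in> flip"
    | x y y' where "u = (x, y)" "v = (x, y')" "(y, y') \<in> flip"
    by (auto simp: box_product_def)
  then show "(case u of (x, y) \<Rightarrow> x \<union> y, case v of (x, y) \<Rightarrow> x \<union> y) \<in> flip"
  proof cases
    case 1
    with u v have "x \<subseteq> A" "x' \<subseteq> A" "y \<subseteq> B" using X(3) Y(3) by auto
    then have "sym_diff (x \<union> y) (x' \<union> y) = sym_diff x x'" using AB by blast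
    with 1 show ?thesis by (simp add: flip_def)
  next
    case 2
    with u v have "x \<subseteq> A" "y' \<subseteq> B" "y \<subseteq> B" using X(3) Y(3) by auto
    then have "sym_diff (x \<union> y) (x \<union> y') = sym_diff y y'" using AB by blast
    with 2 show ?thesis by (simp add: flip_def)
  qed
qed

lemma log_isoperimetric_Pow_singleton: "log_isoperimetric 1 (Pow {b}) flip"
proof (rule log_isoperimetricI)
  fix S assume S: "S \<subseteq> Pow {b}" "S \<noteq> {}" "S \<noteq> Pow {b}"
  then have "S = {{}} \<or> S = {{b}}" by (auto simp: Pow_insert)
  then obtain p where p: "card S = 1" "p \<in> boundary flip (Pow {b}) S"
  proof
    assume "S = {{}}" then show ?thesis
      by (intro that[of "({}, {b})"]) (auto simp: boundary_def flip_def)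
  next
    assume "S = {{b}}" then show ?thesis
      by (intro that[of "({b}, {})"]) (auto simp: boundary_def flip_def)
  qed
  have "1 \<le> card (boundary flip (Pow {b}) S)"
    using p finite_boundary[OF _ S(1), of flip] by (simp add: Suc_le_eq card_gt_0_iff) blast
  with p show "1 * (real (card S) * log 2 (card (Pow {b}) / card S)) \<le> card (boundary flip (Pow {b}) S)"
    by (simp add: card_Pow)
qed

lemma log_isoperimetric_Pow: "finite B \<Longrightarrow> log_isoperimetric 1 (Pow B) flip"
proof (induction B rule: finite_induct)
  case empty
  show ?case by (rule log_isoperimetricI) auto
next
  case (insert b B)
  have "log_isoperimetric 1 ((\<lambda>(x, y). x \<union> y) ` (Pow {b} \<times> Pow B)) flip"
    using insert by (intro log_isoperimetric_join[of _ _ "{b}" _ B] log_isoperimetric_Pow_singleton) auto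
  moreover have "(\<lambda>(x, y). x \<union> y) ` (Pow {b} \<times> Pow B) = Pow (insert b B)"
  proof (intro equalityI subsetI)
    fix z assume "z \<in> Pow (insert b B)"
    then have "z = (\<lambda>(x, y). x \<union> y) (z \<inter> {b}, z \<inter> B)" by auto
    then show "z \<in> (\<lambda>(x, y). x \<union> y) ` (Pow {b} \<times> Pow B)" by (rule image_eqI) auto
  qed auto
  ultimately show ?case by simp
qed

section \<open>Cubes without two antipodal vertices\<close>

definition punctured_cube :: "'a set \<Rightarrow> 'a set \<Rightarrow> 'a set set" where
  "punctured_cube B W = Pow B - {W, B - W}"

lemma punctured_cube_subset_Pow: "punctured_cube B W \<subseteq> Pow B"
  by (auto simp: punctured_cube_def)

lemma finite_punctured_cube: "finite B \<Longrightarrow> finite (punctured_cube B W)"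
  by (simp add: punctured_cube_def)

lemma card_punctured_cube:
  assumes "finite B" "W \<subseteq> B" "B \<noteq> {}"
  shows "card (punctured_cube B W) = 2 ^ card B - 2"
proof -
  have "W \<noteq> B - W" using assms by blast
  then show ?thesis using assms
    by (simp add: punctured_cube_def card_Diff_subset card_Pow)
qed

text \<open>Enlarging a set and its ambient set by the same number of points does not decrease
  \<open>s log (N / s)\<close>: this is the log-sum inequality for the pairs \<open>(s, N)\<close> and \<open>(e, e)\<close>. It pays for the
  poles when the punctured cube is completed to the whole cube.\<close>
lemma xlog_le:
  fixes s N e :: real
  assumes s: "0 < s" "s \<le> N" and e: "0 \<le> e" "e \<le> 2"
  shows "s * log 2 (N / s) \<le> (s + e) * log 2 ((N + 2) / (s + e))"
proof -
  define r where "r = (N + 2) / (s + e)"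
  have r: "r > 0" using assms by (simp add: r_def)
  have "ln (N / s) - ln r = ln (N / s / r)" "- ln r = ln (1 / r)"
    by (rule ln_divide_pos[symmetric], use r s in simp_all)
      (use r in \<open>simp add: ln_divide_pos\<close>)
  moreover have "ln (N / s / r) \<le> N / s / r - 1" "ln (1 / r) \<le> 1 / r - 1"
    using r s by (intro ln_le_minus_one divide_pos_pos; simp)+
  ultimately have "ln (N / s) - ln r \<le> N / s / r - 1" "- ln r \<le> 1 / r - 1"
    by metis+
  then have "s * (ln (N / s) - ln r) \<le> s * (N / s / r - 1)" "e * (- ln r) \<le> e * (1 / r - 1)"
    using s e by (intro mult_left_mono; simp)+
  moreover have "s * (N / s / r - 1) + e * (1 / r - 1) \<le> 0"
  proof -
    have "s * (N / s / r - 1) + e * (1 / r - 1) = (N + e) / r - (s + e)"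
      using r s by (simp add: field_simps)
    also have "(N + e) / r \<le> (N + 2) / r" using r e by (simp add: divide_right_mono)
    also have "(N + 2) / r = s + e" using s e by (simp add: r_def)
    finally show ?thesis by simp
  qed
  ultimately have "s * (ln (N / s) - ln r) + e * (- ln r) \<le> 0" by linarith
  then have "s * ln (N / s) \<le> (s + e) * ln r" by (simp add: algebra_simps)
  then show ?thesis by (simp add: log_def divide_right_mono flip: r_def)
qed


lemma sym_diff_cancel: "sym_diff q (sym_diff q x) = x"
  by blast

text \<open>Let \<open>A\<close> be the set of directions \<open>b\<close> in which the neighbour of the pole \<open>q\<close> belongs to \<open>S\<close>. For
  \<open>b \<in> A\<close> and \<open>b' \<in> B - A\<close> the two neighbours of \<open>q\<close> in directions \<open>b\<close> and \<open>b'\<close> have a second common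
  neighbour, obtained from \<open>q\<close> by flipping both. One of the two edges of the path through it is in the
  boundary of \<open>S\<close>, and this edge determines \<open>{b, b'}\<close>. The condition on the distances to \<open>q\<close> says that
  the edge joins distance 1 to distance 2.\<close>
lemma pole_pairs_le:
  assumes B: "finite B" "q \<subseteq> B" and V: "finite V" and S: "S \<subseteq> V"
    and near: "\<And>x. x \<subseteq> B \<Longrightarrow> card (sym_diff q x) \<in> {1, 2} \<Longrightarrow> x \<in> V"
  defines "A \<equiv> {b \<in> B. sym_diff q {b} \<in> S}"
  shows "card A * (card B - card A)
    \<le> card {(u, v) \<in> boundary flip V S. card (sym_diff q u) + card (sym_diff q v) = 3}"
    (is "_ \<le> card ?N")
proof -
  \<comment> \<open>The boundary edge on the path, and the pair of directions recovered from it.\<close>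
  define f where "f = (\<lambda>(b, b'). let m = sym_diff q {b, b'} in
    if m \<in> S then (m, sym_diff q {b'}) else (sym_diff q {b}, m))"
  define g where "g = (\<lambda>(u, v). sym_diff q u \<union> sym_diff q v)"
  have gf: "g (f (b, b')) = {b, b'}" for b b'
    by (auto simp: g_def f_def Let_def sym_diff_cancel)
  have "inj_on f (A \<times> (B - A))"
  proof (rule inj_onI, clarify)
    fix b b' c c' assume *: "b \<in> A" "c \<in> A" "b' \<notin> A" "c' \<notin> A" and "f (b, b') = f (c, c')"
    then have "{b, b'} = {c, c'}" using gf by metis
    with * show "b = c \<and> b' = c'" by (auto simp: doubleton_eq_iff)
  qed
  moreover have "f ` (A \<times> (B - A)) \<subseteq> ?N"
  proof (rule image_subsetI)
    fix p assume "p \<in> A \<times> (B - A)"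
    then obtain b b' where p: "p = (b, b')" and b: "b \<in> A" and b': "b' \<in> B" "b' \<notin> A"
      by blast
    define m where "m = sym_diff q {b, b'}"
    have bB: "b \<in> B" "sym_diff q {b} \<in> S" and b'S: "sym_diff q {b'} \<notin> S" and ne: "b \<noteq> b'"
      using b b' by (auto simp: A_def)
    have mV: "m \<in> V" and b'V: "sym_diff q {b'} \<in> V"
      using bB b' B ne by (auto intro!: near simp: m_def sym_diff_cancel)
    have fl: "(sym_diff q {b}, m) \<in> flip" "(m, sym_diff q {b'}) \<in> flip"
    proof -
      have "sym_diff (sym_diff q {b}) m = {b'}" "sym_diff m (sym_diff q {b'}) = {b}"
        using ne by (auto simp: m_def)
      then show "(sym_diff q {b}, m) \<in> flip" "(m, sym_diff q {b'}) \<in> flip"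
        unfolding flip_def by blast+
    qed
    have c: "card (sym_diff q m) = 2" "card (sym_diff q (sym_diff q {b})) = 1"
      "card (sym_diff q (sym_diff q {b'})) = 1"
      unfolding m_def sym_diff_cancel using ne by auto
    show "f p \<in> ?N"
    proof (cases "m \<in> S")
      case True
      then have "f (b, b') = (m, sym_diff q {b'})" by (simp add: f_def m_def Let_def)
      then show ?thesis using True fl(2) b'S b'V c by (simp add: boundary_def p)
    next
      case False
      then have "f (b, b') = (sym_diff q {b}, m)" by (simp add: f_def m_def Let_def)
      then show ?thesis using False fl(1) bB mV c by (simp add: boundary_def p)
    qed
  qed
  moreover have "finite ?N"
    by (rule finite_subset[OF _ finite_boundary[OF V S, of flip]]) auto
  ultimately have "card (A \<times> (B - A)) \<le> card ?N" by (rule card_inj_on_le)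
  moreover have "A \<subseteq> B" by (auto simp: A_def)
  ultimately show ?thesis using B finite_subset by (fastforce simp: card_cartesian_product card_Diff_subset)
qed

lemma card_sym_diff_complement:
  assumes "finite B" "W \<subseteq> B" "u \<subseteq> B"
  shows "card (sym_diff (B - W) u) = card B - card (sym_diff W u)"
proof -
  have "sym_diff (B - W) u = B - sym_diff W u" using assms by blast
  moreover have "sym_diff W u \<subseteq> B" using assms by blast
  ultimately show ?thesis using assms(1) by (metis card_Diff_subset finite_subset)
qed

lemma min_mult_le: 
  fixes a k :: nat assumes "a \<le> k"
  shows "k * min a (k - a) \<le> 2 * (a * (k - a))"
proof (cases "a \<le> k - a")
  case True
  then have "k * a \<le> (2 * (k - a)) * a" using assms by (intro mult_right_mono) auto
  with True show ?thesis by (simp add: min_def mult_ac)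
next
  case False
  then have "k * (k - a) \<le> (2 * a) * (k - a)" by (intro mult_right_mono) auto
  with False show ?thesis by (simp add: min_def mult_ac)
qed

text \<open>Complete \<open>S\<close> to a subset \<open>T\<close> of the whole cube by adding each pole that has more than half of its
  neighbours in \<open>S\<close>. A pole with \<open>a\<close> neighbours in \<open>S\<close> then costs \<open>min a (k - a) \<le> 2 a (k - a) / k\<close> extra
  boundary edges, and \<open>a (k - a)\<close> is at most the number of boundary edges of \<open>S\<close> between distances
  1 and 2 from that pole. For \<open>k \<ge> 4\<close> no edge is of this type for both poles, so that all extra edges
  together are at most \<open>2 / k \<le> 1 / 2\<close> of the boundary of \<open>S\<close>. Hence \<open>|\<partial>T| \<le> 3/2 |\<partial>S|\<close>, and the
  inequality for the cube applies to \<open>T\<close>.\<close>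
lemma log_isoperimetric_punctured_cube_ge_4:
  assumes B: "finite B" and W: "W \<subseteq> B" and k: "card B \<ge> 4"
  shows "log_isoperimetric (2 / 3) (punctured_cube B W) flip"
proof (rule log_isoperimetricI)
  let ?V = "punctured_cube B W" and ?k = "card B"
  fix S assume S: "S \<subseteq> ?V" and "S \<noteq> {}" "S \<noteq> ?V"
  have fV: "finite ?V" using B by (rule finite_punctured_cube)
  have cV: "card ?V = 2 ^ ?k - 2" using B W k by (intro card_punctured_cube) auto
  have fS: "finite S" using S fV by (rule finite_subset)
  define P where "P = {W, B - W}"
  have PB: "q \<subseteq> B" if "q \<in> P" for q using that W by (auto simp: P_def)
  have V: "?V = Pow B - P" by (simp add: punctured_cube_def P_def)
  have "B \<noteq> {}" using k by auto
  then have WB: "W \<noteq> B - W" using W by blast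
  then have P2: "card P = 2" by (simp add: P_def)
  define a where "a q = card {b \<in> B. sym_diff q {b} \<in> S}" for q
  have ak: "a q \<le> ?k" for q unfolding a_def using B by (intro card_mono) auto
  \<comment> \<open>Poles join the side of the majority of their neighbours; \<open>extra q\<close> are the boundary edges
    that this creates at \<open>q\<close>, and \<open>near q\<close> are the boundary edges of \<open>S\<close> that pay for them.\<close>
  define T where "T = S \<union> {q \<in> P. ?k < 2 * a q}"
  define extra where "extra q = (if q \<in> T then (\<lambda>b. (q, sym_diff q {b})) ` {b \<in> B. sym_diff q {b} \<notin> S}
      else (\<lambda>b. (sym_diff q {b}, q)) ` {b \<in> B. sym_diff q {b} \<in> S})" for q
  define near where "near q = {(u, v) \<in> boundary flip ?V S. card (sym_diff q u) + card (sym_diff q v) = 3}" for q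
  have SP: "S \<inter> P = {}" using S V by auto
  have TB: "T \<subseteq> Pow B" using S V PB by (auto simp: T_def)
  have card_extra: "card (extra q) \<le> min (a q) (?k - a q)" if q: "q \<in> P" for q
  proof -
    have "{b \<in> B. sym_diff q {b} \<notin> S} = B - {b \<in> B. sym_diff q {b} \<in> S}" by auto
    then have *: "card {b \<in> B. sym_diff q {b} \<notin> S} = ?k - a q"
      using B by (simp add: a_def card_Diff_subset)
    have "q \<in> T \<longleftrightarrow> ?k < 2 * a q" using q SP by (auto simp: T_def)
    moreover have "card (extra q) \<le> (if q \<in> T then ?k - a q else a q)"
      using * B by (auto simp: extra_def a_def intro: order_trans[OF card_image_le])
    ultimately show ?thesis by (auto simp: min_def)
  qed
  \<comment> \<open>The two poles are not adjacent, so that every extra edge has only one endpoint that is a pole.\<close>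
  have far: "(q, q') \<notin> flip" if "q \<in> P" "q' \<in> P" for q q'
  proof
    assume "(q, q') \<in> flip"
    then have "card (sym_diff q q') = 1" by (auto simp: flip_def)
    moreover have "sym_diff q q' = {} \<or> sym_diff q q' = B" using that W by (auto simp: P_def)
    ultimately show False using k by auto
  qed
  have nbr: "\<exists>b\<in>B. u = sym_diff q {b}" if "u \<subseteq> B" "q \<in> P" "(u, q) \<in> flip \<or> (q, u) \<in> flip" for u q
  proof -
    have "(q, u) \<in> flip" using that flip_commute by blast
    then obtain b where b: "sym_diff q u = {b}" by (auto simp: flip_def)
    then have "b \<in> B" using PB that by blast
    moreover have "u = sym_diff q {b}" using sym_diff_cancel[of q u] b by simp
    ultimately show ?thesis by blast
  qed
  have "boundary flip (Pow B) T \<subseteq> boundary flip ?V S \<union> (\<Union>q\<in>P. extra q)"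
  proof
    fix p assume "p \<in> boundary flip (Pow B) T"
    then obtain u v where p: "p = (u, v)" and fl: "(u, v) \<in> flip" and u: "u \<in> T" "u \<subseteq> B"
      and v: "v \<notin> T" "v \<subseteq> B" using TB by (auto simp: boundary_def)
    have "v \<notin> S" using v by (simp add: T_def)
    consider "u \<in> P" | "v \<in> P" | "u \<notin> P" "v \<notin> P" by blast
    then show "p \<in> boundary flip ?V S \<union> (\<Union>q\<in>P. extra q)"
    proof cases
      case 1
      then obtain b where "b \<in> B" "v = sym_diff u {b}" using nbr[OF v(2) 1] fl by blast
      then have "p \<in> extra u" using u \<open>v \<notin> S\<close> by (simp add: extra_def p)
      then show ?thesis using 1 by blast
    next
      case 2
      then obtain b where b: "b \<in> B" "u = sym_diff v {b}" using nbr[OF u(2) 2] fl by blast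
      moreover have "u \<in> S" using u far[OF _ 2] fl by (auto simp: T_def)
      ultimately have "p \<in> extra v" using v by (simp add: extra_def p)
      then show ?thesis using 2 by blast
    next
      case 3
      then have "u \<in> S" using u by (simp add: T_def)
      with 3 \<open>v \<notin> S\<close> fl v show ?thesis by (simp add: V boundary_def p)
    qed
  qed
  then have "card (boundary flip (Pow B) T) \<le> card (boundary flip ?V S \<union> (\<Union>q\<in>P. extra q))"
    by (rule card_mono[rotated]) (use finite_boundary[OF fV S] B in \<open>auto simp: P_def extra_def\<close>)
  also have "\<dots> \<le> card (boundary flip ?V S) + (\<Sum>q\<in>P. card (extra q))"
    by (intro order_trans[OF card_Un_le] add_left_mono card_UN_le) (simp add: P_def)
  finally have cut_T: "card (boundary flip (Pow B) T) \<le> card (boundary flip ?V S) + (\<Sum>q\<in>P. card (extra q))" .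
  have "(\<Sum>q\<in>P. ?k * card (extra q)) \<le> (\<Sum>q\<in>P. 2 * card (near q))"
  proof (rule sum_mono)
    fix q assume q: "q \<in> P"
    have "?k * card (extra q) \<le> ?k * min (a q) (?k - a q)"
      using card_extra[OF q] by (rule mult_left_mono) simp
    also have "\<dots> \<le> 2 * (a q * (?k - a q))" using ak by (rule min_mult_le)
    also have "a q * (?k - a q) \<le> card (near q)"
      unfolding a_def near_def
    proof (rule pole_pairs_le[OF B PB[OF q] fV S])
      fix x assume x: "x \<subseteq> B" "card (sym_diff q x) \<in> {1, 2}"
      have "x \<notin> P"
      proof
        assume "x \<in> P"
        then have "sym_diff q x = {} \<or> sym_diff q x = B" using q W by (auto simp: P_def)
        then show False using x k by auto
      qed
      with x show "x \<in> ?V" by (simp add: V)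
    qed
    finally show "?k * card (extra q) \<le> 2 * card (near q)" by simp
  qed
  moreover have "(\<Sum>q\<in>P. card (near q)) \<le> card (boundary flip ?V S)"
  proof -
    have "near W \<inter> near (B - W) = {}"
    proof (intro equals0I)
      fix p assume "p \<in> near W \<inter> near (B - W)"
      then obtain u v where uv: "u \<subseteq> B" "v \<subseteq> B"
        "card (sym_diff W u) + card (sym_diff W v) = 3"
        "card (sym_diff (B - W) u) + card (sym_diff (B - W) v) = 3"
        using S by (auto simp: near_def V boundary_def)
      then show False
        unfolding card_sym_diff_complement[OF B W uv(1)] card_sym_diff_complement[OF B W uv(2)]
        using k by linarith
    qed
    moreover have sub: "near q \<subseteq> boundary flip ?V S" for q by (auto simp: near_def)
    moreover have "finite (near q)" for q using sub finite_boundary[OF fV S] by (rule finite_subset)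
    ultimately have "(\<Sum>q\<in>P. card (near q)) = card (near W \<union> near (B - W))"
      using WB by (simp add: P_def card_Un_disjoint)
    also have "\<dots> \<le> card (boundary flip ?V S)"
      using sub finite_boundary[OF fV S] by (intro card_mono) auto
    finally show ?thesis .
  qed
  ultimately have "?k * (\<Sum>q\<in>P. card (extra q)) \<le> 2 * card (boundary flip ?V S)"
    by (simp add: sum_distrib_left[symmetric])
  moreover have "4 * (\<Sum>q\<in>P. card (extra q)) \<le> ?k * (\<Sum>q\<in>P. card (extra q))"
    using k by (intro mult_right_mono) auto
  ultimately have "2 * card (boundary flip (Pow B) T) \<le> 3 * card (boundary flip ?V S)"
    using cut_T by linarith
  then have lower: "2 / 3 * card (boundary flip (Pow B) T) \<le> card (boundary flip ?V S)"
    by linarith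
  have "card T = card S + card {q \<in> P. ?k < 2 * a q}"
    unfolding T_def using SP fS by (intro card_Un_disjoint) (auto simp: P_def)
  moreover have "card {q \<in> P. ?k < 2 * a q} \<le> 2"
    unfolding P2[symmetric] by (intro card_mono) (auto simp: P_def)
  ultimately obtain e where e: "card T = card S + e" "e \<le> 2" by blast
  have s: "0 < card S" "card S \<le> card ?V"
    using \<open>S \<noteq> {}\<close> fS fV S by (auto simp: card_gt_0_iff card_mono)
  have "(2::nat) ^ 1 \<le> 2 ^ ?k" using k by (intro power_increasing) auto
  then have "real (card ?V) + 2 = card (Pow B)" using B by (simp add: cV card_Pow of_nat_diff)
  then have "card S * log 2 (card ?V / card S) \<le> card T * log 2 (card (Pow B) / card T)"
    using xlog_le[of "card S" "card ?V" e] s e by simp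
  also have "\<dots> \<le> card (boundary flip (Pow B) T)"
    using log_isoperimetricD[OF log_isoperimetric_Pow[OF B] TB] by simp
  finally show "2 / 3 * (card S * log 2 (card ?V / card S)) \<le> card (boundary flip ?V S)"
    using lower by linarith
qed

lemma log2_le_of_power:
  assumes "0 < x" "x ^ n \<le> 2 ^ m" "0 < n"
  shows "log 2 x \<le> m / n"
proof -
  have "n * log 2 x = log 2 (x ^ n)" using assms by (simp add: log_nat_power)
  also have "\<dots> \<le> log 2 (2 ^ m)" using assms by (subst log_le_cancel_iff) auto
  finally show ?thesis using assms by (simp add: field_simps log_nat_power)
qed

text \<open>The most demanding value is \<open>s = 2\<close>, where the inequality says \<open>log 2 3 \<le> 12 / 7\<close>, that is
  \<open>3 ^ 7 \<le> 2 ^ 12\<close>.\<close>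
lemma xlog_6_le:
  fixes s :: nat assumes "s \<le> 6"
  shows "7 / 12 * (s * log 2 (6 / s)) \<le> 2"
proof -
  consider "s = 0" | "s = 1" | "s = 2" | "s = 3" | "s = 4" | "s = 5" | "s = 6"
    using assms by linarith
  then show ?thesis
  proof cases
    case 2 then show ?thesis using log2_le_of_power[of 6 1 3] by simp
  next
    case 3 then show ?thesis using log2_le_of_power[of 3 7 12] by simp
  next
    case 5 then show ?thesis using log2_le_of_power[of "3 / 2" 7 6] by (simp add: power_divide)
  next
    case 6 then show ?thesis using log2_le_of_power[of "6 / 5" 2 1] by (simp add: power_divide)
  qed auto
qed

text \<open>The graph is a 6-cycle. Following it around, in the one and in the other orientation, leaves \<open>S\<close>
  somewhere, so there are at least two boundary edges, and two suffice for every size of \<open>S\<close>.\<close>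
lemma log_isoperimetric_hexagon:
  assumes "card B = 3"
  shows "log_isoperimetric (7 / 12) (punctured_cube B {}) flip"
proof (rule log_isoperimetricI)
  let ?V = "punctured_cube B {}"
  fix S assume S: "S \<subseteq> ?V" "S \<noteq> {}" "S \<noteq> ?V"
  obtain a b c where B: "B = {a, b, c}" and ne: "a \<noteq> b" "b \<noteq> c" "a \<noteq> c"
    using assms by (auto simp: card_3_iff)
  have V: "?V = {{a}, {a, b}, {b}, {b, c}, {c}, {a, c}}"
    using ne by (auto simp: punctured_cube_def B Pow_insert)
  define C where "C = {({a}, {a, b}), ({a, b}, {b}), ({b}, {b, c}), ({b, c}, {c}), ({c}, {a, c}), ({a, c}, {a})}"
  have C: "(u, v) \<in> flip" "u \<in> ?V" "v \<in> ?V" if "(u, v) \<in> C" for u v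
    using that ne unfolding V by (auto simp: C_def flip_def)
  have "\<exists>(u, v) \<in> C. u \<in> S \<and> v \<notin> S"
  proof (rule ccontr)
    assume "\<not> ?thesis"
    then have "\<forall>(u, v) \<in> C. u \<in> S \<longrightarrow> v \<in> S" by blast
    then have "?V \<subseteq> S \<or> ?V \<inter> S = {}" unfolding V C_def by simp blast
    with S show False by blast
  qed
  then obtain u v where uv: "(u, v) \<in> C" "(u, v) \<in> boundary flip ?V S"
    using C by (auto simp: boundary_def)
  have "\<exists>(u, v) \<in> C. u \<notin> S \<and> v \<in> S"
  proof (rule ccontr)
    assume "\<not> ?thesis"
    then have "\<forall>(u, v) \<in> C. v \<in> S \<longrightarrow> u \<in> S" by blast
    then have "?V \<subseteq> S \<or> ?V \<inter> S = {}" unfolding V C_def by simp blast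
    with S show False by blast
  qed
  then obtain u' v' where uv': "(u', v') \<in> C" "(v', u') \<in> boundary flip ?V S"
    using C flip_commute by (fastforce simp: boundary_def)
  have "(u, v) \<noteq> (v', u')"
    using uv(1) uv'(1) ne unfolding C_def by (auto simp: doubleton_eq_iff)
  then have "2 = card {(u, v), (v', u')}" by simp
  also have "\<dots> \<le> card (boundary flip ?V S)"
    using uv uv' S(1) by (intro card_mono finite_boundary) (auto simp: V)
  finally have "2 \<le> real (card (boundary flip ?V S))" by linarith
  moreover have "card ?V = 6" using ne assms by (subst card_punctured_cube) (auto simp: B)
  moreover have "card S \<le> card ?V" using S by (intro card_mono) (simp add: V)
  ultimately show "7 / 12 * (card S * log 2 (card ?V / card S)) \<le> card (boundary flip ?V S)"
    using xlog_6_le[of "card S"] by simp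
qed

lemma log_isoperimetric_punctured_cube:
  assumes B: "finite B" "3 \<le> card B" and W: "W \<subseteq> B"
  shows "log_isoperimetric (7 / 12) (punctured_cube B W) flip"
proof (cases "card B = 3")
  case False
  then show ?thesis
    using assms by (intro log_isoperimetric_mono[OF log_isoperimetric_punctured_cube_ge_4])
      (auto simp: finite_punctured_cube)
next
  case True
  have "bij_betw (sym_diff W) (punctured_cube B {}) (punctured_cube B W)"
    by (rule bij_betw_byWitness[where f' = "sym_diff W"])
      (use W in \<open>auto simp: punctured_cube_def sym_diff_cancel\<close>)
  moreover have "(sym_diff W u, sym_diff W v) \<in> flip" if "(u, v) \<in> flip" for u v
  proof -
    have "sym_diff (sym_diff W u) (sym_diff W v) = sym_diff u v" by blast
    then show ?thesis using that by (simp only: flip_def mem_Collect_eq split)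
  qed
  ultimately show ?thesis
    using finite_punctured_cube[OF B(1)]
    by (intro log_isoperimetric_transport[OF log_isoperimetric_hexagon[OF True]])
qed

section \<open>Products of punctured cubes\<close>

text \<open>The free coordinates, those outside of all blocks, form a cube. In each block \<open>B\<close>, the set \<open>W B\<close>
  and its complement are the poles.\<close>
definition block_family :: "'a set \<Rightarrow> 'a set set \<Rightarrow> ('a set \<Rightarrow> 'a set) \<Rightarrow> 'a set set" where
  "block_family G \<B> W = {x. x \<subseteq> G \<and> (\<forall>B\<in>\<B>. x \<inter> B \<noteq> W B \<and> x \<inter> B \<noteq> B - W B)}"

lemma block_family_subset_Pow: "block_family G \<B> W \<subseteq> Pow G"
  by (auto simp: block_family_def)

lemma finite_block_family: "finite G \<Longrightarrow> finite (block_family G \<B> W)"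
  using finite_subset[OF block_family_subset_Pow] by auto

lemma log_isoperimetric_block_family:
  assumes "finite \<B>" "finite G" "disjoint \<B>"
    and "\<And>B. B \<in> \<B> \<Longrightarrow> B \<subseteq> G \<and> 3 \<le> card B \<and> W B \<subseteq> B"
  shows "log_isoperimetric (7 / 12) (block_family G \<B> W) flip"
  using assms
proof (induction \<B> arbitrary: G rule: finite_induct)
  case empty
  have "block_family G {} W = Pow G" by (auto simp: block_family_def)
  then show ?case
    using log_isoperimetric_mono[OF log_isoperimetric_Pow, of G "7 / 12"] empty by simp
next
  case (insert B \<B>)
  have dis: "B \<inter> B' = {}" if "B' \<in> \<B>" for B'
    using disjointD[OF insert.prems(2), of B B'] that insert.hyps by auto
  have B: "3 \<le> card B" "W B \<subseteq> B" "B \<subseteq> G" using insert.prems(3)[of B] by auto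
  then have fB: "finite B" using insert.prems(1) finite_subset by blast
  have "log_isoperimetric (7 / 12) (block_family (G - B) \<B> W) flip"
  proof (rule insert.IH)
    show "disjoint \<B>" using insert.prems by (simp add: pairwise_insert)
    show "B' \<subseteq> G - B \<and> 3 \<le> card B' \<and> W B' \<subseteq> B'" if "B' \<in> \<B>" for B'
      using insert.prems(3)[of B'] dis[OF that] that by auto
  qed (use insert.prems in simp)
  then have "log_isoperimetric (7 / 12)
      ((\<lambda>(x, y). x \<union> y) ` (punctured_cube B (W B) \<times> block_family (G - B) \<B> W)) flip"
    using log_isoperimetric_punctured_cube[OF fB B(1,2)] fB insert.prems(1)
    by (intro log_isoperimetric_join[of _ _ B _ "G - B"] finite_punctured_cube finite_block_family)
      (simp_all add: block_family_subset_Pow punctured_cube_subset_Pow)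
  moreover have "(\<lambda>(x, y). x \<union> y) ` (punctured_cube B (W B) \<times> block_family (G - B) \<B> W)
      = block_family G (insert B \<B>) W"
  proof (intro equalityI subsetI)
    fix z assume "z \<in> (\<lambda>(x, y). x \<union> y) ` (punctured_cube B (W B) \<times> block_family (G - B) \<B> W)"
    then obtain x y where z: "z = x \<union> y" and x: "x \<subseteq> B" "x \<noteq> W B" "x \<noteq> B - W B"
      and y: "y \<in> block_family (G - B) \<B> W" by (auto simp: punctured_cube_def)
    have yB: "y \<subseteq> G - B" using y by (simp add: block_family_def)
    have zB: "z \<inter> B = x" using z x yB by blast
    have zB': "z \<inter> B' = y \<inter> B'" if "B' \<in> \<B>" for B' using dis[OF that] x z by blast
    have "z \<inter> B' \<noteq> W B' \<and> z \<inter> B' \<noteq> B' - W B'" if "B' \<in> insert B \<B>" for B'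
    proof (cases "B' = B")
      case True
      then show ?thesis using zB x by simp
    next
      case False
      with that have "B' \<in> \<B>" by simp
      then show ?thesis using zB' y unfolding block_family_def by simp
    qed
    moreover have "z \<subseteq> G" using x(1) yB B z by blast
    ultimately show "z \<in> block_family G (insert B \<B>) W" unfolding block_family_def by blast
  next
    fix z assume z: "z \<in> block_family G (insert B \<B>) W"
    have "(z - B) \<inter> B' = z \<inter> B'" if "B' \<in> \<B>" for B' using dis[OF that] by blast
    then have "z - B \<in> block_family (G - B) \<B> W"
      using z unfolding block_family_def by (simp add: Diff_mono)
    moreover have "z \<inter> B \<in> punctured_cube B (W B)"
      using z unfolding block_family_def punctured_cube_def by simp
    ultimately have "(z \<inter> B, z - B) \<in> punctured_cube B (W B) \<times> block_family (G - B) \<B> W"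
      by simp
    moreover have "z = (\<lambda>(x, y). x \<union> y) (z \<inter> B, z - B)" by auto
    ultimately show "z \<in> (\<lambda>(x, y). x \<union> y) ` (punctured_cube B (W B) \<times> block_family (G - B) \<B> W)"
      by (rule rev_image_eqI)
  qed
  ultimately show ?case by simp
qed

section \<open>Zonotopes generated by pairwise non-parallel vectors\<close>

text \<open>The translation \<open>p\<close> is a parameter of the locale but not of its predicate, because the
  assumptions concern \<open>G\<close> only. That distinct segments are not parallel makes each of them a
  translate of an edge, and it excludes dependencies with only two terms.\<close>
locale zonotope_generators =
  fixes p :: "'a::euclidean_space" and G :: "'a set"
  assumes fin: "finite G" and nonzero: "0 \<notin> G"
    and noncollinear: "\<And>g h c. g \<in> G \<Longrightarrow> h \<in> G \<Longrightarrow> g \<noteq> h \<Longrightarrow> h \<noteq> c *\<^sub>R g"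
begin

definition Z :: "'a set" where
  "Z = {p} + (\<Sum>g\<in>G. closed_segment 0 g)"

end

lemma closed_segment_0: "closed_segment 0 v = {t *\<^sub>R v | t. 0 \<le> t \<and> t \<le> 1}"
  by (auto simp: closed_segment_def)

lemma closed_segment_eq_translate: "closed_segment a b = {a} + closed_segment 0 (b - a)"
  using closed_segment_translation[of a 0 "b - a"] by (simp add: set_plus_def) blast

lemma closed_segment_plus_parallel:
  fixes g :: "'a::real_vector"
  assumes "0 \<le> c"
  shows "closed_segment 0 g + closed_segment 0 (c *\<^sub>R g) = closed_segment 0 ((1 + c) *\<^sub>R g)"
proof (intro equalityI subsetI)
  fix z assume "z \<in> closed_segment 0 g + closed_segment 0 (c *\<^sub>R g)"
  then obtain s t where st: "0 \<le> s" "s \<le> 1" "0 \<le> t" "t \<le> 1" and z: "z = s *\<^sub>R g + t *\<^sub>R c *\<^sub>R g"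
    by (auto simp: closed_segment_0 elim!: set_plus_elim)
  have "t * c \<le> 1 * c" using st assms by (intro mult_right_mono)
  then have "0 \<le> (s + t * c) / (1 + c)" "(s + t * c) / (1 + c) \<le> 1"
    using st assms by (auto intro!: divide_nonneg_nonneg)
  moreover have "z = ((s + t * c) / (1 + c)) *\<^sub>R (1 + c) *\<^sub>R g"
    using assms z by (simp add: scaleR_left_distrib[symmetric] del: scaleR_left_distrib)
  ultimately show "z \<in> closed_segment 0 ((1 + c) *\<^sub>R g)" unfolding closed_segment_0 by blast
next
  fix z assume "z \<in> closed_segment 0 ((1 + c) *\<^sub>R g)"
  then obtain t where "0 \<le> t" "t \<le> 1" "z = t *\<^sub>R g + t *\<^sub>R c *\<^sub>R g"
    by (auto simp: closed_segment_0 algebra_simps)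
  then show "z \<in> closed_segment 0 g + closed_segment 0 (c *\<^sub>R g)"
    by (auto simp: closed_segment_0 intro!: set_plus_intro)
qed

lemma set_plus_singletons: "{a} + {b} = {a + b}" for a b :: "'a::ab_group_add"
  by (auto simp: set_plus_def)

text \<open>A segment parallel to a generator \<open>g\<close> is absorbed by stretching \<open>g\<close>; otherwise it contributes a new
  generator.\<close>
lemma zonotope_generators_add_segment:
  fixes p :: "'a::euclidean_space"
  assumes "zonotope_generators G"
  shows "\<exists>p' G'. zonotope_generators G' \<and>
    zonotope_generators.Z p G + closed_segment a b = zonotope_generators.Z p' G'"
proof -
  interpret zonotope_generators p G by fact
  consider "b = a" | g where "g \<in> G" "b \<noteq> a" "\<exists>c. b - a = c *\<^sub>R g"
    | "b \<noteq> a" "\<And>g c. g \<in> G \<Longrightarrow> b - a \<noteq> c *\<^sub>R g" by blast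
  then show ?thesis
  proof cases
    case 1
    have "Z + closed_segment a b = ({p} + {a}) + (\<Sum>g\<in>G. closed_segment 0 g)"
      unfolding Z_def using 1 by (simp add: ac_simps)
    also have "\<dots> = zonotope_generators.Z (p + a) G"
      by (simp add: zonotope_generators.Z_def[OF assms] set_plus_singletons)
    finally show ?thesis using assms by blast
  next
    case 2
    \<comment> \<open>Swapping the endpoints of the segment makes the factor nonnegative.\<close>
    obtain a' c where c: "0 \<le> c" and seg: "closed_segment a b = {a'} + closed_segment 0 (c *\<^sub>R g)"
    proof -
      from 2 obtain c where eq: "b - a = c *\<^sub>R g" by blast
      show ?thesis
      proof (cases "0 \<le> c")
        case True
        then show ?thesis using that[of c a] eq closed_segment_eq_translate[of a b] by simp
      next
        case False
        have "a - b = (- c) *\<^sub>R g" using eq by (simp add: algebra_simps)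
        then show ?thesis
          using that[of "- c" b] False closed_segment_eq_translate[of b a]
          by (simp add: closed_segment_commute)
      qed
    qed
    define g' where "g' = (1 + c) *\<^sub>R g"
    define G' where "G' = insert g' (G - {g})"
    have g0: "g \<noteq> 0" using 2 nonzero by auto
    have g_eq: "g = (1 / (1 + c)) *\<^sub>R g'" using c by (simp add: g'_def)
    have notin: "g' \<notin> G - {g}"
      using noncollinear[of g g' "1 + c"] 2(1) g'_def by blast
    have gen: "zonotope_generators G'"
    proof
      show "finite G'" using fin by (simp add: G'_def)
      show "0 \<notin> G'" using nonzero g0 c by (auto simp: G'_def g'_def)
      fix h k d assume hk: "h \<in> G'" "k \<in> G'" "h \<noteq> k"
      show "k \<noteq> d *\<^sub>R h"
      proof
        assume eq: "k = d *\<^sub>R h"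
        consider "h \<in> G - {g}" "k \<in> G - {g}" | "h = g'" "k \<in> G - {g}" | "k = g'" "h \<in> G - {g}"
          using hk by (auto simp: G'_def)
        then show False
        proof cases
          case 1 then show ?thesis using noncollinear[of h k d] hk eq by auto
        next
          case 2
          then show ?thesis using noncollinear[of g k "d * (1 + c)"] \<open>g \<in> G\<close> eq by (auto simp: g'_def)
        next
          case 3
          have "g = (1 / (1 + c) * d) *\<^sub>R h"
            using g_eq[folded 3(1), unfolded eq] by (simp only: scaleR_scaleR)
          then show ?thesis using noncollinear[of h g "1 / (1 + c) * d"] 3 \<open>g \<in> G\<close> by auto
        qed
      qed
    qed
    have "Z + closed_segment a b = zonotope_generators.Z (p + a') G'"
    proof -
      have "Z + closed_segment a b = ({p} + {a'}) + ((closed_segment 0 g + closed_segment 0 (c *\<^sub>R g))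
          + (\<Sum>g\<in>G - {g}. closed_segment 0 g))"
        unfolding Z_def seg using 2 fin by (simp add: sum.remove ac_simps)
      also have "\<dots> = {p + a'} + (\<Sum>g\<in>G'. closed_segment 0 g)"
        unfolding closed_segment_plus_parallel[OF c] G'_def g'_def[symmetric]
        using fin notin by (simp add: set_plus_singletons)
      finally show ?thesis using gen by (simp add: zonotope_generators.Z_def)
    qed
    with gen show ?thesis by blast
  next
    case 3
    define v where "v = b - a"
    define G' where "G' = insert v G"
    have "v \<notin> G" using 3(2)[of v 1] by (auto simp: v_def)
    have gen: "zonotope_generators G'"
    proof
      show "finite G'" using fin by (simp add: G'_def)
      show "0 \<notin> G'" using nonzero 3(1) by (auto simp: G'_def v_def)
      fix h k d assume hk: "h \<in> G'" "k \<in> G'" "h \<noteq> k"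
      show "k \<noteq> d *\<^sub>R h"
      proof
        assume eq: "k = d *\<^sub>R h"
        consider "h \<in> G" "k \<in> G" | "h \<in> G" "k = v" | "h = v" "k \<in> G"
          using hk by (auto simp: G'_def)
        then show False
        proof cases
          case 1 then show ?thesis using noncollinear[of h k d] hk eq by auto
        next
          case 2 then show ?thesis using 3(2)[of h d] eq by (auto simp: v_def)
        next
          case 3
          then have "d \<noteq> 0" using eq nonzero by auto
          then have "v = (1 / d) *\<^sub>R k" using eq 3 by simp
          then show ?thesis using \<open>\<And>g c. g \<in> G \<Longrightarrow> b - a \<noteq> c *\<^sub>R g\<close>[of k "1 / d"] 3 by (auto simp: v_def)
        qed
      qed
    qed
    have "Z + closed_segment a b = zonotope_generators.Z (p + a) G'"
    proof -
      have "Z + closed_segment a b = ({p} + {a}) + (closed_segment 0 v + (\<Sum>g\<in>G. closed_segment 0 g))"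
        unfolding Z_def closed_segment_eq_translate[of a b] v_def by (simp add: ac_simps)
      also have "\<dots> = {p + a} + (\<Sum>g\<in>G'. closed_segment 0 g)"
        using fin \<open>v \<notin> G\<close> by (simp add: G'_def set_plus_singletons)
      finally show ?thesis using gen by (simp add: zonotope_generators.Z_def)
    qed
    with gen show ?thesis by blast
  qed
qed

lemma zonotope_imp_generators:
  assumes "zonotope (Z :: 'a::euclidean_space set)"
  obtains p G where "zonotope_generators G" "Z = zonotope_generators.Z p G"
proof -
  obtain m and a b :: "nat \<Rightarrow> 'a" where Z: "Z = (\<Sum>i<m. closed_segment (a i) (b i))"
    using assms by (auto simp: zonotope_def)
  have "\<exists>p G. zonotope_generators G \<and> (\<Sum>i<m. closed_segment (a i) (b i)) = zonotope_generators.Z p G"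
  proof (induction m)
    case 0
    have empty: "zonotope_generators ({} :: 'a set)" by unfold_locales auto
    then have "(\<Sum>i<0. closed_segment (a i) (b i)) = zonotope_generators.Z 0 {}"
      by (simp add: zonotope_generators.Z_def flip: set_zero)
    with empty show ?case by blast
  next
    case (Suc m)
    then show ?case using zonotope_generators_add_segment by fastforce
  qed
  with Z that show thesis by blast
qed

section \<open>Vertices and edges of a zonotope\<close>

context zonotope_generators
begin

lemma mem_Z_iff:
  "z \<in> Z \<longleftrightarrow> (\<exists>t. (\<forall>g\<in>G. 0 \<le> t g \<and> t g \<le> 1) \<and> z = p + (\<Sum>g\<in>G. t g *\<^sub>R g))"
proof
  assume "z \<in> Z"
  then obtain s where s: "\<forall>g\<in>G. s g \<in> closed_segment 0 g" and z: "z = p + sum s G"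
    using fin by (auto simp: Z_def set_sum_alt elim!: set_plus_elim)
  from s have "\<forall>g\<in>G. \<exists>t. 0 \<le> t \<and> t \<le> 1 \<and> s g = t *\<^sub>R g" by (auto simp: closed_segment_0)
  then obtain t where t: "\<forall>g\<in>G. 0 \<le> t g \<and> t g \<le> 1 \<and> s g = t g *\<^sub>R g" by metis
  then have "z = p + (\<Sum>g\<in>G. t g *\<^sub>R g)" using z by (simp cong: sum.cong)
  with t show "\<exists>t. (\<forall>g\<in>G. 0 \<le> t g \<and> t g \<le> 1) \<and> z = p + (\<Sum>g\<in>G. t g *\<^sub>R g)" by blast
next
  assume "\<exists>t. (\<forall>g\<in>G. 0 \<le> t g \<and> t g \<le> 1) \<and> z = p + (\<Sum>g\<in>G. t g *\<^sub>R g)"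
  then show "z \<in> Z"
    unfolding Z_def set_sum_alt[OF fin] closed_segment_0 by (fastforce intro: set_plus_intro)
qed

lemma polytope_Z: "polytope Z"
proof -
  have "Z = convex hull ({p} + (\<Sum>g\<in>G. {0, g}))"
    by (simp add: Z_def convex_hull_set_plus convex_hull_set_sum segment_convex_hull)
  moreover have "finite (\<Sum>g\<in>G. {0, g})"
    using fin by (induction G rule: finite_induct) (auto simp: set_zero intro: finite_set_plus)
  ultimately show ?thesis unfolding polytope_def by (metis finite.emptyI finite.insertI finite_set_plus)
qed

lemma convex_Z: "convex Z"
  using polytope_Z by (rule polytope_imp_convex)

definition corner :: "'a set \<Rightarrow> 'a" where
  "corner x = p + \<Sum>x"

lemma corner_eq: "x \<subseteq> G \<Longrightarrow> corner x = p + (\<Sum>g\<in>G. of_bool (g \<in> x) *\<^sub>R g)"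
proof -
  assume "x \<subseteq> G"
  then have "(\<Sum>g\<in>G. of_bool (g \<in> x) *\<^sub>R g) = (\<Sum>g\<in>x. of_bool (g \<in> x) *\<^sub>R g)"
    using fin by (intro sum.mono_neutral_right) auto
  also have "\<dots> = \<Sum>x" by (rule sum.cong) auto
  finally show ?thesis by (simp add: corner_def)
qed

lemma corner_in_Z: "x \<subseteq> G \<Longrightarrow> corner x \<in> Z"
  unfolding mem_Z_iff by (rule exI[of _ "\<lambda>g. of_bool (g \<in> x)"]) (simp add: corner_eq)

lemma corner_insert: "x \<subseteq> G \<Longrightarrow> g \<notin> x \<Longrightarrow> corner (insert g x) = corner x + g"
  using fin by (simp add: corner_def finite_subset algebra_simps)

text \<open>If \<open>w\<close> is nonnegative on \<open>x\<close> and nonpositive on \<open>G - x\<close>, all summands on the right are nonnegative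
  for \<open>0 \<le> t g \<le> 1\<close>. So \<open>corner x\<close> maximises \<open>w\<close> on the zonotope, and a maximiser has no choice
  for \<open>t g\<close> unless \<open>w \<bullet> g = 0\<close>.\<close>
lemma inner_gap:
  assumes "x \<subseteq> G"
  shows "w \<bullet> corner x - w \<bullet> (p + (\<Sum>g\<in>G. t g *\<^sub>R g)) = (\<Sum>g\<in>G. (of_bool (g \<in> x) - t g) * (w \<bullet> g))"
  unfolding corner_eq[OF assms]
  by (simp add: inner_add_right inner_sum_right left_diff_distrib sum_subtractf)

definition weakly_separates :: "'a \<Rightarrow> 'a set \<Rightarrow> bool" where
  "weakly_separates w x \<longleftrightarrow> x \<subseteq> G \<and> (\<forall>g\<in>x. 0 \<le> w \<bullet> g) \<and> (\<forall>g\<in>G - x. w \<bullet> g \<le> 0)"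

definition separates :: "'a \<Rightarrow> 'a set \<Rightarrow> bool" where
  "separates w x \<longleftrightarrow> x \<subseteq> G \<and> (\<forall>g\<in>x. 0 < w \<bullet> g) \<and> (\<forall>g\<in>G - x. w \<bullet> g < 0)"

lemma separates_imp_weakly: "separates w x \<Longrightarrow> weakly_separates w x"
  unfolding separates_def weakly_separates_def by (meson less_imp_le)

lemma separates_imp_nonzero: "separates w x \<Longrightarrow> g \<in> G \<Longrightarrow> w \<bullet> g \<noteq> 0"
  unfolding separates_def by (metis DiffI less_irrefl)

lemma weakly_separates_gap_nonneg:
  assumes "weakly_separates w x" "0 \<le> s" "s \<le> 1" "g \<in> G"
  shows "0 \<le> (of_bool (g \<in> x) - s) * (w \<bullet> g)"
proof (cases "g \<in> x")
  case True then show ?thesis using assms by (simp add: weakly_separates_def)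
next
  case False
  then have "w \<bullet> g \<le> 0" using assms by (simp add: weakly_separates_def)
  then show ?thesis using False assms by (simp add: mult_nonneg_nonpos)
qed

lemma inner_le_corner:
  assumes w: "weakly_separates w x" and z: "z \<in> Z"
  shows "w \<bullet> z \<le> w \<bullet> corner x"
proof -
  obtain t where t: "\<forall>g\<in>G. 0 \<le> t g \<and> t g \<le> 1" and z: "z = p + (\<Sum>g\<in>G. t g *\<^sub>R g)"
    using z by (auto simp: mem_Z_iff)
  have "0 \<le> (\<Sum>g\<in>G. (of_bool (g \<in> x) - t g) * (w \<bullet> g))"
    using t by (intro sum_nonneg weakly_separates_gap_nonneg[OF w]) auto
  then show ?thesis using inner_gap[of x w t] w z by (simp add: weakly_separates_def)
qed

lemma inner_eq_corner:
  assumes w: "weakly_separates w x" and t: "\<forall>g\<in>G. 0 \<le> t g \<and> t g \<le> 1"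
    and eq: "w \<bullet> (p + (\<Sum>g\<in>G. t g *\<^sub>R g)) = w \<bullet> corner x"
    and g: "g \<in> G" "w \<bullet> g \<noteq> 0"
  shows "t g = of_bool (g \<in> x)"
proof -
  have "(\<Sum>g\<in>G. (of_bool (g \<in> x) - t g) * (w \<bullet> g)) = 0"
    using inner_gap[of x w t] w eq by (simp add: weakly_separates_def)
  moreover have "0 \<le> (of_bool (h \<in> x) - t h) * (w \<bullet> h)" if "h \<in> G" for h
    using t that by (intro weakly_separates_gap_nonneg[OF w]) auto
  ultimately have "(of_bool (g \<in> x) - t g) * (w \<bullet> g) = 0"
    using g(1) fin by (simp add: sum_nonneg_eq_0_iff)
  then show ?thesis using g by simp
qed

lemma face_of_weakly_separates:
  "weakly_separates w x \<Longrightarrow> (Z \<inter> {z. w \<bullet> z = w \<bullet> corner x}) face_of Z"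
  using convex_Z inner_le_corner by (intro face_of_Int_supporting_hyperplane_le)

lemma separates_imp_vertex:
  assumes w: "separates w x"
  shows "corner x \<in> vertices Z"
proof -
  have "z = corner x" if "z \<in> Z" "w \<bullet> z = w \<bullet> corner x" for z
  proof -
    obtain t where t: "\<forall>g\<in>G. 0 \<le> t g \<and> t g \<le> 1" and z: "z = p + (\<Sum>g\<in>G. t g *\<^sub>R g)"
      using \<open>z \<in> Z\<close> by (auto simp: mem_Z_iff)
    have eq: "w \<bullet> (p + (\<Sum>g\<in>G. t g *\<^sub>R g)) = w \<bullet> corner x" using that z by simp
    have "t g = of_bool (g \<in> x)" if "g \<in> G" for g
      by (rule inner_eq_corner[OF separates_imp_weakly[OF w] t eq that separates_imp_nonzero[OF w that]])
    then have "z = p + (\<Sum>g\<in>G. of_bool (g \<in> x) *\<^sub>R g)" using z by (simp cong: sum.cong)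
    then show ?thesis using w by (simp add: corner_eq separates_def)
  qed
  then have "Z \<inter> {z. w \<bullet> z = w \<bullet> corner x} = {corner x}"
    using w corner_in_Z by (auto simp: separates_def)
  then show ?thesis
    using face_of_weakly_separates[OF separates_imp_weakly[OF w]]
    by (simp add: face_of_singleton vertices_def)
qed

text \<open>A functional that vanishes on exactly one generator \<open>g\<close> exposes a translate of the segment \<open>[0, g]\<close>,
  because only the coefficient of \<open>g\<close> is left free on the face.\<close>
lemma separates_edge:
  assumes w: "weakly_separates w x" and g: "g \<in> G" "g \<notin> x"
    and zero: "\<And>h. h \<in> G \<Longrightarrow> w \<bullet> h = 0 \<longleftrightarrow> h = g"
  shows "{corner x, corner (insert g x)} \<in> graph_edges Z"
    and "corner x \<in> vertices Z" "corner (insert g x) \<in> vertices Z"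
proof -
  have xG: "x \<subseteq> G" using w by (simp add: weakly_separates_def)
  let ?F = "Z \<inter> {z. w \<bullet> z = w \<bullet> corner x}" and ?e = "closed_segment (corner x) (corner (insert g x))"
  have ins: "corner (insert g x) = corner x + g" using xG g by (simp add: corner_insert)
  have "?F = ?e"
  proof (intro equalityI subsetI)
    fix z assume "z \<in> ?F"
    then have "z \<in> Z" and wz: "w \<bullet> z = w \<bullet> corner x" by auto
    then obtain t where t: "\<forall>g\<in>G. 0 \<le> t g \<and> t g \<le> 1" and z: "z = p + (\<Sum>g\<in>G. t g *\<^sub>R g)"
      unfolding mem_Z_iff by blast
    have "t h = of_bool (h \<in> x)" if "h \<in> G - {g}" for h
      using inner_eq_corner[OF w t wz[unfolded z], of h] that zero by blast
    then have "(\<Sum>h\<in>G - {g}. t h *\<^sub>R h) = (\<Sum>h\<in>G - {g}. of_bool (h \<in> x) *\<^sub>R h)" by simp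
    then have "z = corner x + t g *\<^sub>R g"
      using g fin by (simp add: z corner_eq[OF xG] sum.remove[of G g])
    then have "z = (1 - t g) *\<^sub>R corner x + t g *\<^sub>R (corner x + g)"
      by (simp add: scaleR_right_distrib scaleR_left_diff_distrib)
    then show "z \<in> ?e" unfolding ins in_segment using t g(1) by blast
  next
    fix z assume "z \<in> ?e"
    moreover have "?e \<subseteq> Z"
      using xG g by (intro closed_segment_subset corner_in_Z convex_Z) auto
    moreover have "w \<bullet> z = w \<bullet> corner x" if "z \<in> ?e"
    proof -
      obtain u where "z = (1 - u) *\<^sub>R corner x + u *\<^sub>R (corner x + g)"
        using \<open>z \<in> ?e\<close> unfolding ins in_segment by blast
      then have "z = corner x + u *\<^sub>R g"
        by (simp add: scaleR_right_distrib scaleR_left_diff_distrib)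
      then show ?thesis using zero[OF g(1)] by (simp add: inner_add_right)
    qed
    ultimately show "z \<in> ?F" by blast
  qed
  then have F: "?e face_of Z" using face_of_weakly_separates[OF w] by simp
  have "g \<noteq> 0" using g nonzero by auto
  then have ne: "corner x \<noteq> corner (insert g x)" by (simp add: ins)
  then have "aff_dim ?e = 1" by (simp add: segment_convex_hull aff_dim_convex_hull aff_dim_2)
  then have "?e edge_of Z" using F by (simp add: edge_of_def)
  moreover have "vertices ?e = {corner x, corner (insert g x)}"
    by (auto simp: vertices_def extreme_point_of_segment)
  ultimately show "{corner x, corner (insert g x)} \<in> graph_edges Z"
    unfolding graph_edges_def by (metis image_eqI mem_Collect_eq)
  show "corner x \<in> vertices Z" "corner (insert g x) \<in> vertices Z"
    using extreme_point_of_face[OF F] by (auto simp: vertices_def extreme_point_of_segment)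
qed

definition separable :: "'a set set" where
  "separable = {x. \<exists>w. separates w x}"

lemma inj_on_corner: "inj_on corner separable"
proof (rule inj_onI)
  fix x y assume "x \<in> separable" "y \<in> separable" and eq: "corner x = corner y"
  then obtain w where w: "separates w x" and y: "y \<subseteq> G"
    by (auto simp: separable_def separates_def)
  have "of_bool (g \<in> y) = (of_bool (g \<in> x) :: real)" if "g \<in> G" for g
    by (rule inner_eq_corner[OF separates_imp_weakly[OF w] _ _ that separates_imp_nonzero[OF w that]])
      (simp_all add: eq flip: corner_eq[OF y])
  then have "g \<in> x \<longleftrightarrow> g \<in> y" if "g \<in> G" for g using that by (metis of_bool_eq_iff)
  then show "x = y" using y w by (auto simp: separates_def)
qed

text \<open>Every vertex of a polytope is exposed by some functional \<open>w\<close>. No generator is orthogonal to \<open>w\<close>, for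
  it could be added without leaving the face; hence \<open>w\<close> separates the generators on which it is
  positive from the others.\<close>
lemma vertices_eq: "vertices Z = corner ` separable"
proof (intro equalityI subsetI)
  fix v assume "v \<in> corner ` separable"
  then show "v \<in> vertices Z" using separates_imp_vertex by (auto simp: separable_def)
next
  fix v assume "v \<in> vertices Z"
  then have "{v} face_of Z" by (simp add: vertices_def face_of_singleton)
  then have "{v} exposed_face_of Z"
    using exposed_face_of_polyhedron[OF polytope_imp_polyhedron[OF polytope_Z]] by simp
  then obtain w c where Zw: "Z \<subseteq> {z. w \<bullet> z \<le> c}" and v: "{v} = Z \<inter> {z. w \<bullet> z = c}"
    by (auto simp: exposed_face_of_def)
  define x where "x = {g \<in> G. 0 < w \<bullet> g}"
  have x: "weakly_separates w x" by (auto simp: weakly_separates_def x_def)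
  then have xG: "x \<subseteq> G" by (simp add: weakly_separates_def)
  have "w \<bullet> corner x = c"
  proof (rule antisym)
    show "w \<bullet> corner x \<le> c" using Zw corner_in_Z[OF xG] by blast
    have "v \<in> Z" "w \<bullet> v = c" using v by auto
    then show "c \<le> w \<bullet> corner x" using inner_le_corner[OF x] by blast
  qed
  then have vx: "corner x = v" using v corner_in_Z[OF xG] by auto
  have "w \<bullet> g \<noteq> 0" if g: "g \<in> G" for g
  proof
    assume 0: "w \<bullet> g = 0"
    then have gx: "g \<notin> x" by (simp add: x_def)
    have "corner (insert g x) \<in> Z" using xG g by (intro corner_in_Z) auto
    moreover have "w \<bullet> corner (insert g x) = c"
      using 0 \<open>w \<bullet> corner x = c\<close> corner_insert[OF xG gx] by (simp add: inner_add_right)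
    ultimately have "corner (insert g x) = v" using v by blast
    then have "g = 0" using corner_insert[OF xG gx] vx by simp
    then show False using g nonzero by simp
  qed
  then have "separates w x" by (force simp: separates_def x_def)
  then show "v \<in> corner ` separable" using vx by (auto simp: separable_def)
qed

text \<open>The functionals \<open>w\<close> and \<open>w'\<close> for the two vertices disagree in sign on \<open>g\<close> only, so a positive
  combination of them vanishes on \<open>g\<close> and keeps the strict signs on the other generators.\<close>
lemma separable_insert_edge:
  assumes x: "x \<in> separable" and y: "insert g x \<in> separable" and g: "g \<notin> x"
  shows "{corner x, corner (insert g x)} \<in> graph_edges Z"
proof -
  obtain w w' where w: "separates w x" and w': "separates w' (insert g x)"
    using x y by (auto simp: separable_def)
  have gG: "g \<in> G" using w' by (auto simp: separates_def)
  define a b where "a = w' \<bullet> g" and "b = - (w \<bullet> g)"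
  have ab: "0 < a" "0 < b" using w w' g gG by (auto simp: a_def b_def separates_def)
  define v where "v = a *\<^sub>R w + b *\<^sub>R w'"
  have v: "v \<bullet> h = a * (w \<bullet> h) + b * (w' \<bullet> h)" for h by (simp add: v_def inner_simps)
  have "v \<bullet> g = 0" by (simp add: v a_def b_def)
  moreover have pos: "0 < v \<bullet> h" if "h \<in> x" for h
    using that w w' ab unfolding v by (intro add_pos_pos mult_pos_pos) (auto simp: separates_def)
  moreover have neg: "v \<bullet> h < 0" if "h \<in> G - x" "h \<noteq> g" for h
    using that w w' ab unfolding v by (intro add_neg_neg mult_pos_neg) (auto simp: separates_def)
  ultimately have "weakly_separates v x"
    using w unfolding weakly_separates_def separates_def by (metis DiffE less_imp_le order_refl)
  moreover have "v \<bullet> h = 0 \<longleftrightarrow> h = g" if "h \<in> G" for h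
    using pos neg \<open>v \<bullet> g = 0\<close> that by (metis DiffI less_irrefl)
  ultimately show ?thesis using gG g by (intro separates_edge)
qed

text \<open>A functional vanishing on \<open>g\<close> and on no other generator is found by projecting a generic vector \<open>w0\<close>
  to the orthogonal complement of \<open>g\<close>. The vectors to avoid form finitely many hyperplanes, because
  the projection \<open>r h\<close> of any other generator \<open>h\<close> is nonzero; such a union is a null set.\<close>
lemma generator_is_vertex_difference:
  assumes g: "g \<in> G"
  obtains u v where "u \<in> vertices Z" "v \<in> vertices Z" "g = v - u"
proof -
  define r where "r h = h - ((h \<bullet> g) / (g \<bullet> g)) *\<^sub>R g" for h
  have g0: "g \<bullet> g \<noteq> 0" using g nonzero by auto
  have r: "r h \<noteq> 0" if "h \<in> G" "h \<noteq> g" for h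
    using noncollinear[of g h "(h \<bullet> g) / (g \<bullet> g)"] that g by (auto simp: r_def)
  have "negligible (\<Union>h\<in>G - {g}. {w. r h \<bullet> w = 0})"
    using fin r by (intro negligible_Union) (auto intro!: negligible_hyperplane)
  then have "(\<Union>h\<in>G - {g}. {w. r h \<bullet> w = 0}) \<noteq> UNIV" by (metis non_negligible_UNIV)
  then obtain w0 where w0: "\<And>h. h \<in> G \<Longrightarrow> h \<noteq> g \<Longrightarrow> r h \<bullet> w0 \<noteq> 0" by blast
  define w where "w = r w0"
  have w: "w \<bullet> h = r h \<bullet> w0" for h
    using g0 by (simp add: w_def r_def inner_simps inner_commute)
  have wg: "w \<bullet> g = 0" using g0 by (simp add: w_def r_def inner_simps)
  then have zero: "w \<bullet> h = 0 \<longleftrightarrow> h = g" if "h \<in> G" for h using w w0 that by auto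
  define x where "x = {h \<in> G. 0 < w \<bullet> h}"
  have x: "weakly_separates w x" "g \<notin> x" "x \<subseteq> G" using wg by (auto simp: weakly_separates_def x_def)
  show thesis
    using separates_edge(2,3)[OF x(1) g x(2) zero] corner_insert[OF x(3,2)] that by simp
qed

end

section \<open>Linear dependencies between generators\<close>

context zonotope_generators
begin

definition dependency :: "('a \<Rightarrow> real) \<Rightarrow> bool" where
  "dependency \<mu> \<longleftrightarrow> (\<Sum>g\<in>G. \<mu> g *\<^sub>R g) = 0"

lemma dependency_scale: "dependency \<mu> \<Longrightarrow> dependency (\<lambda>g. c * \<mu> g)"
  by (simp add: dependency_def scaleR_sum_right[symmetric] flip: scaleR_scaleR)

lemma dependency_diff: "dependency \<mu> \<Longrightarrow> dependency \<nu> \<Longrightarrow> dependency (\<lambda>g. \<mu> g - \<nu> g)"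
  by (simp add: dependency_def scaleR_left_diff_distrib sum_subtractf)

definition conformal :: "('a \<Rightarrow> real) \<Rightarrow> 'a set \<Rightarrow> bool" where
  "conformal \<mu> x \<longleftrightarrow> (\<forall>g\<in>G. (0 < \<mu> g \<longrightarrow> g \<in> x) \<and> (\<mu> g < 0 \<longrightarrow> g \<notin> x))"

text \<open>The easy half of Gordan's theorem: applying the functional to the dependency gives a sum of
  nonnegative terms that vanishes.\<close>
lemma separates_imp_no_conformal_dependency:
  assumes w: "separates w x" and \<mu>: "dependency \<mu>" "conformal \<mu> x" and g: "g \<in> G"
  shows "\<mu> g = 0"
proof -
  have pos: "0 < \<mu> h * (w \<bullet> h)" if "h \<in> G" "\<mu> h \<noteq> 0" for h
  proof (cases "0 < \<mu> h")
    case True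
    then show ?thesis using that w \<mu>(2) by (auto simp: conformal_def separates_def)
  next
    case False
    then have "\<mu> h < 0" using that by simp
    then show ?thesis using that w \<mu>(2) by (auto simp: conformal_def separates_def intro: mult_neg_neg)
  qed
  have "(\<Sum>h\<in>G. \<mu> h * (w \<bullet> h)) = w \<bullet> (\<Sum>h\<in>G. \<mu> h *\<^sub>R h)" by (simp add: inner_sum_right)
  also have "\<dots> = 0" using \<mu>(1) by (simp add: dependency_def)
  finally have "(\<Sum>h\<in>G. \<mu> h * (w \<bullet> h)) = 0" .
  moreover have "0 \<le> \<mu> h * (w \<bullet> h)" if "h \<in> G" for h using pos[OF that] by (cases "\<mu> h = 0") auto
  ultimately have "\<mu> g * (w \<bullet> g) = 0" using g fin by (simp add: sum_nonneg_eq_0_iff)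
  with pos[OF g] show ?thesis by auto
qed

text \<open>The other half of Gordan's theorem. Reverse the generators outside of \<open>x\<close>. If 0 is not in the convex
  hull of the resulting vectors, a hyperplane separating 0 from this hull yields a functional that is
  positive on all of them; otherwise the convex combination that represents 0 is the dependency.\<close>
lemma not_separable_imp_conformal_dependency:
  assumes x: "x \<subseteq> G" "x \<notin> separable"
  obtains \<mu> g where "dependency \<mu>" "conformal \<mu> x" "g \<in> G" "\<mu> g \<noteq> 0"
proof -
  define f where "f h = (if h \<in> x then h else - h)" for h
  have inj: "inj_on f G"
  proof (rule inj_onI, rule ccontr)
    fix g h assume gh: "g \<in> G" "h \<in> G" "f g = f h" "g \<noteq> h"
    then have "h = (-1) *\<^sub>R g" by (auto simp: f_def split: if_splits)
    then show False using noncollinear[of g h "-1"] gh by blast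
  qed
  have "0 \<in> convex hull (f ` G)"
  proof (rule ccontr)
    assume "0 \<notin> convex hull (f ` G)"
    moreover have "closed (convex hull (f ` G))"
      using fin by (intro compact_imp_closed finite_imp_compact_convex_hull) simp
    ultimately obtain w b where b: "0 < b" "\<And>y. y \<in> convex hull (f ` G) \<Longrightarrow> b < w \<bullet> y"
      using separating_hyperplane_closed_0[of "convex hull (f ` G)"] by auto
    have "0 < w \<bullet> f h" if "h \<in> G" for h
      using b(2)[of "f h"] b(1) that hull_subset[of "f ` G" convex] by force
    then have "separates w x" using x by (force simp: separates_def f_def)
    then show False using x by (auto simp: separable_def)
  qed
  then obtain u where u: "\<forall>y\<in>f ` G. 0 \<le> u y" "sum u (f ` G) = 1" "(\<Sum>y\<in>f ` G. u y *\<^sub>R y) = 0"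
    using fin by (auto simp: convex_hull_finite)
  define \<mu> where "\<mu> h = (if h \<in> x then u (f h) else - u (f h))" for h
  have "(\<Sum>h\<in>G. \<mu> h *\<^sub>R h) = (\<Sum>h\<in>G. u (f h) *\<^sub>R f h)"
    by (rule sum.cong) (auto simp: \<mu>_def f_def)
  also have "\<dots> = 0" using u(3) by (simp add: sum.reindex[OF inj])
  finally have "dependency \<mu>" by (simp add: dependency_def)
  moreover have "conformal \<mu> x" using u(1) by (force simp: conformal_def \<mu>_def)
  moreover have "\<exists>g\<in>G. \<mu> g \<noteq> 0"
  proof (rule ccontr)
    assume "\<not> ?thesis"
    then have "u (f g) = 0" if "g \<in> G" for g using that by (auto simp: \<mu>_def split: if_splits)
    then show False using u(2) by (simp add: sum.reindex[OF inj])
  qed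
  ultimately show thesis using that by blast
qed

text \<open>For half-integral zonotopes this is the equivalence relation generated by having a common nonzero
  coordinate, up to identifying all generators that occur in no dependency. The form chosen here is
  visibly an equivalence relation.\<close>
definition linked :: "'a \<Rightarrow> 'a \<Rightarrow> bool" where
  "linked g h \<longleftrightarrow> (\<forall>\<mu>. dependency \<mu> \<longrightarrow> \<bar>\<mu> g\<bar> = \<bar>\<mu> h\<bar>)"

definition block_of :: "'a \<Rightarrow> 'a set" where
  "block_of g = {h \<in> G. linked g h}"

definition blocks :: "'a set set" where
  "blocks = {block_of g | g. g \<in> G \<and> (\<exists>\<mu>. dependency \<mu> \<and> \<mu> g \<noteq> 0)}"

lemma blocks_subset: "B \<in> blocks \<Longrightarrow> B \<subseteq> G"
  by (auto simp: blocks_def block_of_def)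

lemma finite_blocks: "finite blocks"
  by (rule finite_subset[of _ "Pow G"]) (use blocks_subset fin in auto)

lemma block_linked: "B \<in> blocks \<Longrightarrow> g \<in> B \<Longrightarrow> h \<in> B \<Longrightarrow> linked g h"
  by (auto simp: blocks_def block_of_def linked_def)

lemma disjoint_blocks: "disjoint blocks"
proof (rule disjointI)
  fix B B' assume "B \<in> blocks" "B' \<in> blocks" "B \<noteq> B'"
  then obtain g g' where B: "B = block_of g" "B' = block_of g'" and ne: "block_of g \<noteq> block_of g'"
    by (auto simp: blocks_def)
  have "\<not> (linked g h \<and> linked g' h)" for h
  proof
    assume "linked g h \<and> linked g' h"
    then have "linked g k \<longleftrightarrow> linked g' k" for k unfolding linked_def by metis
    then show False using ne by (simp add: block_of_def)
  qed
  then show "B \<inter> B' = {}" by (auto simp: B block_of_def)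
qed

end

text \<open>The property that half-integrality supplies: every dependency is the sum of its restrictions to the
  classes of linked generators.\<close>
locale splitting_generators = zonotope_generators +
  assumes dependency_restrict:
    "dependency \<mu> \<Longrightarrow> dependency (\<lambda>h. if h \<in> block_of g then \<mu> h else 0)"
begin

definition signing :: "'a set \<Rightarrow> ('a \<Rightarrow> real) \<Rightarrow> bool" where
  "signing B \<sigma> \<longleftrightarrow> dependency \<sigma> \<and> (\<forall>h\<in>B. \<bar>\<sigma> h\<bar> = 1) \<and> (\<forall>h. h \<notin> B \<longrightarrow> \<sigma> h = 0)"

lemma block_signing:
  assumes "B \<in> blocks"
  obtains \<sigma> where "signing B \<sigma>"
proof -
  obtain g \<mu> where g: "g \<in> G" "B = block_of g" and \<mu>: "dependency \<mu>" "\<mu> g \<noteq> 0"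
    using assms by (auto simp: blocks_def)
  \<comment> \<open>Linked generators have coefficients of the same absolute value, so that one factor normalises all.\<close>
  define \<sigma> where "\<sigma> h = (1 / \<bar>\<mu> g\<bar>) * (if h \<in> block_of g then \<mu> h else 0)" for h
  have "dependency \<sigma>"
    unfolding \<sigma>_def by (rule dependency_scale[OF dependency_restrict[OF \<mu>(1)]])
  moreover have "\<bar>\<sigma> h\<bar> = 1" if "h \<in> B" for h
  proof -
    have "\<bar>\<mu> g\<bar> = \<bar>\<mu> h\<bar>" using that g \<mu>(1) by (simp add: block_of_def linked_def)
    then show ?thesis using that g \<mu>(2) by (auto simp: \<sigma>_def abs_mult)
  qed
  moreover have "\<sigma> h = 0" if "h \<notin> B" for h using that g by (simp add: \<sigma>_def)
  ultimately have "signing B \<sigma>" by (simp add: signing_def)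
  then show thesis by (rule that)
qed

text \<open>Subtract the multiple of \<open>\<sigma>\<close> that agrees with \<open>\<mu>\<close> at \<open>g\<close>. The difference is a dependency that
  vanishes at \<open>g\<close>, and then on all generators linked to \<open>g\<close>.\<close>
lemma dependency_on_block:
  assumes B: "B \<in> blocks" "signing B \<sigma>" and \<mu>: "dependency \<mu>" and g: "g \<in> B"
  shows "\<exists>c. \<forall>h\<in>B. \<mu> h = c * \<sigma> h"
proof -
  define c where "c = \<mu> g / \<sigma> g"
  have \<sigma>g: "\<sigma> g \<noteq> 0" using B g by (auto simp: signing_def)
  have dep: "dependency (\<lambda>h. \<mu> h - c * \<sigma> h)"
    using B(2) \<mu> by (intro dependency_diff dependency_scale) (auto simp: signing_def)
  have "\<mu> h = c * \<sigma> h" if "h \<in> B" for h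
  proof -
    have "\<bar>\<mu> g - c * \<sigma> g\<bar> = \<bar>\<mu> h - c * \<sigma> h\<bar>"
      using block_linked[OF B(1) g that] dep unfolding linked_def by blast
    then show ?thesis using \<sigma>g by (simp add: c_def)
  qed
  then show ?thesis by blast
qed

text \<open>A dependency with one term would make a generator zero, and one with two terms would make two
  generators parallel.\<close>
lemma card_block_ge_3:
  assumes B: "B \<in> blocks"
  shows "3 \<le> card B"
proof -
  obtain \<sigma> where \<sigma>: "signing B \<sigma>" using block_signing[OF B] .
  have BG: "B \<subseteq> G" using B by (rule blocks_subset)
  have ne: "B \<noteq> {}" using B by (auto simp: blocks_def block_of_def linked_def)
  have "(\<Sum>h\<in>B. \<sigma> h *\<^sub>R h) = (\<Sum>h\<in>G. \<sigma> h *\<^sub>R h)"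
    using BG fin \<sigma> by (intro sum.mono_neutral_left) (auto simp: signing_def)
  then have sum0: "(\<Sum>h\<in>B. \<sigma> h *\<^sub>R h) = 0" using \<sigma> by (simp add: signing_def dependency_def)
  have nz: "\<sigma> h \<noteq> 0" if "h \<in> B" for h using \<sigma> that by (auto simp: signing_def)
  have "card B \<noteq> 1"
  proof
    assume "card B = 1"
    then obtain g where "B = {g}" by (auto simp: card_1_singleton_iff)
    then show False using sum0 nz nonzero BG by auto
  qed
  moreover have "card B \<noteq> 2"
  proof
    assume "card B = 2"
    then obtain g h where gh: "B = {g, h}" "g \<noteq> h" by (auto simp: card_2_iff)
    then have "\<sigma> g *\<^sub>R g + \<sigma> h *\<^sub>R h = 0" using sum0 by simp
    then have "\<sigma> h *\<^sub>R h = (- \<sigma> g) *\<^sub>R g" by (simp add: eq_neg_iff_add_eq_0 add.commute)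
    then have "(1 / \<sigma> h) *\<^sub>R \<sigma> h *\<^sub>R h = (1 / \<sigma> h) *\<^sub>R (- \<sigma> g) *\<^sub>R g" by simp
    then have "h = ((1 / \<sigma> h) * (- \<sigma> g)) *\<^sub>R g" using nz[of h] gh unfolding scaleR_scaleR by simp
    then show False using noncollinear[of g h "(1 / \<sigma> h) * (- \<sigma> g)"] gh BG by blast
  qed
  moreover have "card B \<noteq> 0" using ne finite_subset[OF BG fin] by simp
  ultimately show ?thesis by linarith
qed

text \<open>If \<open>x\<close> meets \<open>B\<close> in one of the two forbidden sets, \<open>\<sigma> B\<close> or its negative is a conformal dependency.
  Conversely, a nonzero conformal dependency is nonzero on some block, where it is a multiple of
  the signing; the sign of the factor decides which of the two forbidden sets \<open>x\<close> cuts out.\<close>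
lemma separable_iff_blocks:
  assumes W: "\<And>B. B \<in> blocks \<Longrightarrow> signing B (\<sigma> B) \<and> W B = {h \<in> B. 0 < \<sigma> B h}"
  shows "x \<in> separable \<longleftrightarrow> x \<subseteq> G \<and> (\<forall>B\<in>blocks. x \<inter> B \<noteq> W B \<and> x \<inter> B \<noteq> B - W B)"
proof
  assume "x \<in> separable"
  then obtain w where w: "separates w x" by (auto simp: separable_def)
  have "x \<inter> B \<noteq> W B \<and> x \<inter> B \<noteq> B - W B" if B: "B \<in> blocks" for B
  proof -
    have \<sigma>: "dependency (\<sigma> B)" "\<And>h. h \<in> B \<Longrightarrow> \<bar>\<sigma> B h\<bar> = 1" "\<And>h. h \<notin> B \<Longrightarrow> \<sigma> B h = 0"
      and WB: "W B = {h \<in> B. 0 < \<sigma> B h}"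
      using W[OF B] by (auto simp: signing_def)
    have "B \<noteq> {}" using card_block_ge_3[OF B] by auto
    then obtain g where g: "g \<in> B" "g \<in> G" using blocks_subset[OF B] by blast
    have "\<not> conformal (\<lambda>h. c * \<sigma> B h) x" if "c \<noteq> 0" for c
      using separates_imp_no_conformal_dependency[OF w dependency_scale[OF \<sigma>(1)] _ g(2), of c] \<sigma>(2)[OF g(1)] that
      by auto
    from this[of 1] this[of "-1"] have c: "\<not> conformal (\<sigma> B) x" "\<not> conformal (\<lambda>h. - \<sigma> B h) x" by simp_all
    have out: "h \<in> B" if "\<sigma> B h \<noteq> 0" for h using \<sigma>(3) that by blast
    show ?thesis
    proof
      show "x \<inter> B \<noteq> W B"
      proof
        assume "x \<inter> B = W B"
        then have "h \<in> x \<longleftrightarrow> 0 < \<sigma> B h" if "h \<in> B" for h using that WB by blast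
        then have "conformal (\<sigma> B) x" unfolding conformal_def using out by (metis less_irrefl less_asym)
        with c show False by blast
      qed
      show "x \<inter> B \<noteq> B - W B"
      proof
        assume "x \<inter> B = B - W B"
        then have "h \<in> x \<longleftrightarrow> \<not> 0 < \<sigma> B h" if "h \<in> B" for h using that WB by blast
        then have "conformal (\<lambda>h. - \<sigma> B h) x" unfolding conformal_def neg_0_less_iff_less neg_less_0_iff_less
          using out by (metis less_irrefl less_asym)
        with c show False by blast
      qed
    qed
  qed
  then show "x \<subseteq> G \<and> (\<forall>B\<in>blocks. x \<inter> B \<noteq> W B \<and> x \<inter> B \<noteq> B - W B)"
    using w by (auto simp: separates_def)
next
  assume x: "x \<subseteq> G \<and> (\<forall>B\<in>blocks. x \<inter> B \<noteq> W B \<and> x \<inter> B \<noteq> B - W B)"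
  show "x \<in> separable"
  proof (rule ccontr)
    assume "x \<notin> separable"
    then obtain \<mu> g where \<mu>: "dependency \<mu>" "conformal \<mu> x" and g: "g \<in> G" "\<mu> g \<noteq> 0"
      by (rule not_separable_imp_conformal_dependency[OF conjunct1[OF x]])
    define B where "B = block_of g"
    have B: "B \<in> blocks" using g \<mu>(1) unfolding blocks_def B_def by blast
    have gB: "g \<in> B" using g by (simp add: B_def block_of_def linked_def)
    have WB: "W B = {h \<in> B. 0 < \<sigma> B h}" and \<sigma>: "signing B (\<sigma> B)" using W[OF B] by auto
    obtain c where c: "\<And>h. h \<in> B \<Longrightarrow> \<mu> h = c * \<sigma> B h"
      using dependency_on_block[OF B \<sigma> \<mu>(1) gB] by blast
    have "c \<noteq> 0" using c[OF gB] g by auto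
    have nz: "\<sigma> B h \<noteq> 0" if "h \<in> B" for h using \<sigma> that by (auto simp: signing_def)
    have xB: "h \<in> x \<longleftrightarrow> 0 < c * \<sigma> B h" if "h \<in> B" for h
    proof -
      have "\<mu> h \<noteq> 0" using c[OF that] nz[OF that] \<open>c \<noteq> 0\<close> by simp
      moreover have "h \<in> G" using that blocks_subset[OF B] by blast
      ultimately have "h \<in> x \<longleftrightarrow> 0 < \<mu> h" using \<mu>(2) by (auto simp: conformal_def not_less order_le_less)
      then show ?thesis using c[OF that] by simp
    qed
    show False
    proof (cases "0 < c")
      case True
      then have "x \<inter> B = W B" using xB WB by (auto simp: zero_less_mult_iff)
      with x B show False by blast
    next
      case False
      then have "h \<in> x \<longleftrightarrow> \<sigma> B h < 0" if "h \<in> B" for h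
        using xB[OF that] \<open>c \<noteq> 0\<close> by (auto simp: zero_less_mult_iff)
      then have "h \<in> x \<longleftrightarrow> \<not> 0 < \<sigma> B h" if "h \<in> B" for h
        using that nz[OF that] by (auto simp: not_less order_le_less)
      then have "x \<inter> B = B - W B" using WB by blast
      with x B show False by blast
    qed
  qed
qed

end

section \<open>Half-integrality\<close>

lemma half_integral_mem_unit_cube:
  fixes Z :: "(real ^ 'n) set"
  assumes Z: "polytope Z" "half_integral Z" and z: "z \<in> Z"
  shows "0 \<le> z $ j" "z $ j \<le> 1"
proof -
  have "v \<in> cbox 0 1" if "v \<in> vertices Z" for v
    unfolding mem_box_cart
  proof
    fix i
    have "v $ i \<in> {0, 1/2, 1}" using Z(2) that by (simp add: half_integral_def)
    then show "0 $ i \<le> v $ i \<and> v $ i \<le> 1 $ i" by auto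
  qed
  then have "convex hull (vertices Z) \<subseteq> cbox 0 1"
    by (intro hull_minimal convex_box) auto
  moreover have "Z = convex hull (vertices Z)"
    unfolding vertices_def using Z(1) by (intro Krein_Milman_Minkowski polytope_imp_compact polytope_imp_convex)
  ultimately have "z \<in> cbox 0 1" using z by blast
  then show "0 \<le> z $ j" "z $ j \<le> 1" by (simp_all add: mem_box_cart)
qed

text \<open>The second bound is the width of the zonotope in the direction of coordinate \<open>j\<close>: the corners of
  the generators with positive and with negative \<open>j\<close>-th coordinate lie at the two extremes, and both
  are in the unit cube.\<close>
lemma half_integral_generators:
  fixes G :: "(real ^ 'n) set"
  assumes gens: "zonotope_generators G" and half: "half_integral (zonotope_generators.Z p G)"
  shows "g \<in> G \<Longrightarrow> \<bar>g $ j\<bar> \<in> {0, 1/2, 1}" and "(\<Sum>g\<in>G. \<bar>g $ j\<bar>) \<le> 1"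
proof -
  interpret zonotope_generators p G by fact
  show "\<bar>g $ j\<bar> \<in> {0, 1/2, 1}" if g: "g \<in> G"
  proof -
    obtain u v where uv: "u \<in> vertices Z" "v \<in> vertices Z" "g = v - u"
      using generator_is_vertex_difference[OF g] .
    then have "u $ j \<in> {0, 1/2, 1}" "v $ j \<in> {0, 1/2, 1}"
      using half by (auto simp: half_integral_def)
    then show ?thesis using uv(3) by auto
  qed
  define P N where "P = {g \<in> G. 0 < g $ j}" and "N = {g \<in> G. g $ j < 0}"
  have PN: "P \<subseteq> G" "N \<subseteq> G" by (auto simp: P_def N_def)
  have "(\<Sum>g\<in>G. \<bar>g $ j\<bar>) = (\<Sum>g\<in>G. of_bool (g \<in> P) * g $ j - of_bool (g \<in> N) * g $ j)"
    by (rule sum.cong) (auto simp: P_def N_def)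
  also have "\<dots> = corner P $ j - corner N $ j"
    by (simp add: corner_eq[OF PN(1)] corner_eq[OF PN(2)] sum_subtractf)
  also have "\<dots> \<le> 1"
    using half_integral_mem_unit_cube[OF polytope_Z half corner_in_Z[OF PN(1)], of j]
      half_integral_mem_unit_cube[OF polytope_Z half corner_in_Z[OF PN(2)], of j] by linarith
  finally show "(\<Sum>g\<in>G. \<bar>g $ j\<bar>) \<le> 1" .
qed

text \<open>For each coordinate, the generators on which it does not vanish are linked to each other, so that
  they are either all inside of a class or all outside of it. In the coordinate, the restriction therefore
  has the same sum as \<open>\<mu>\<close>, or the empty sum.\<close>
lemma (in zonotope_generators) dependency_restrictI:
  fixes coord :: "'i \<Rightarrow> 'a \<Rightarrow> real"
  assumes \<mu>: "dependency \<mu>"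
  assumes lin: "\<And>i. linear (coord i)" and sep: "\<And>v. (\<And>i. coord i v = 0) \<Longrightarrow> v = 0"
    and linked: "\<And>i g h. g \<in> G \<Longrightarrow> h \<in> G \<Longrightarrow> coord i g \<noteq> 0 \<Longrightarrow> coord i h \<noteq> 0 \<Longrightarrow> linked g h"
  shows "dependency (\<lambda>h. if h \<in> block_of g then \<mu> h else 0)"
  unfolding dependency_def
proof (rule sep)
  fix i
  let ?r = "\<lambda>h. if h \<in> block_of g then \<mu> h else 0"
  have coord_sum: "coord i (\<Sum>h\<in>G. \<nu> h *\<^sub>R h) = (\<Sum>h\<in>G. \<nu> h * coord i h)" for \<nu>
    by (simp add: linear_sum[OF lin] linear_cmul[OF lin])
  show "coord i (\<Sum>h\<in>G. ?r h *\<^sub>R h) = 0"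
  proof (cases "\<exists>h\<in>block_of g. coord i h \<noteq> 0")
    case False
    then show ?thesis unfolding coord_sum by (intro sum.neutral) auto
  next
    case True
    then obtain h where h: "h \<in> block_of g" "coord i h \<noteq> 0" by blast
    have "k \<in> block_of g" if "k \<in> G" "coord i k \<noteq> 0" for k
    proof -
      have "linked h k" using linked[of h k i] h that by (auto simp: block_of_def)
      then show ?thesis using h(1) that(1) unfolding block_of_def linked_def by force
    qed
    then have "(\<Sum>h\<in>G. ?r h * coord i h) = (\<Sum>h\<in>G. \<mu> h * coord i h)"
      by (intro sum.cong) auto
    also have "\<dots> = coord i 0" using \<mu> unfolding coord_sum[symmetric] by (simp add: dependency_def)
    finally show ?thesis unfolding coord_sum by (simp add: linear_0[OF lin])
  qed
qed

text \<open>Two distinct generators that share a nonzero coordinate have the absolute value \<open>1/2\<close> there and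
  exhaust the width 1, so that no third generator takes part in the coordinate. A dependency \<open>\<mu>\<close> read
  in this coordinate is \<open>\<mu> g = \<plusminus>\<mu> h\<close>.\<close>
lemma half_integral_imp_splitting_generators:
  fixes G :: "(real ^ 'n) set"
  assumes gens: "zonotope_generators G" and half: "half_integral (zonotope_generators.Z p G)"
  shows "splitting_generators G"
proof -
  interpret zonotope_generators p G by fact
  have linked: "linked g h" if gh: "g \<in> G" "h \<in> G" "g $ j \<noteq> 0" "h $ j \<noteq> 0" for g h j
  proof (cases "g = h")
    case True
    then show ?thesis by (simp add: linked_def)
  next
    case False
    have split: "(\<Sum>k\<in>G. f k) = f g + (f h + (\<Sum>k\<in>G - {g} - {h}. f k))" for f :: "real ^ 'n \<Rightarrow> real"
      using fin gh False by (simp add: sum.remove[of G g] sum.remove[of "G - {g}" h])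
    have ge: "1/2 \<le> \<bar>g $ j\<bar>" "1/2 \<le> \<bar>h $ j\<bar>"
      using half_integral_generators(1)[OF gens half gh(1), of j]
        half_integral_generators(1)[OF gens half gh(2), of j] gh by auto
    have rest: "0 \<le> (\<Sum>k\<in>G - {g} - {h}. \<bar>k $ j\<bar>)" by (rule sum_nonneg) simp
    have le: "\<bar>g $ j\<bar> + (\<bar>h $ j\<bar> + (\<Sum>k\<in>G - {g} - {h}. \<bar>k $ j\<bar>)) \<le> 1"
      using half_integral_generators(2)[OF gens half, of j] unfolding split .
    have eq: "\<bar>g $ j\<bar> = 1/2" "\<bar>h $ j\<bar> = 1/2" "(\<Sum>k\<in>G - {g} - {h}. \<bar>k $ j\<bar>) = 0"
      using ge rest le by linarith+
    have zero: "k $ j = 0" if "k \<in> G - {g} - {h}" for k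
      using eq(3) that fin by (simp add: sum_nonneg_eq_0_iff)
    show ?thesis
      unfolding linked_def
    proof (intro allI impI)
      fix \<mu> assume "dependency \<mu>"
      then have "(\<Sum>k\<in>G. \<mu> k *\<^sub>R k) $ j = 0" by (simp add: dependency_def)
      then have "(\<Sum>k\<in>G. \<mu> k * k $ j) = 0" by simp
      then have "\<mu> g * g $ j = - (\<mu> h * h $ j)" using zero unfolding split by simp
      then have "\<bar>\<mu> g\<bar> * \<bar>g $ j\<bar> = \<bar>\<mu> h\<bar> * \<bar>h $ j\<bar>" by (metis abs_minus_cancel abs_mult)
      then show "\<bar>\<mu> g\<bar> = \<bar>\<mu> h\<bar>" by (simp add: eq)
    qed
  qed
  show ?thesis
  proof
    fix \<mu> :: "real ^ 'n \<Rightarrow> real" and g assume "dependency \<mu>"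
    then show "dependency (\<lambda>h. if h \<in> block_of g then \<mu> h else 0)"
      by (rule dependency_restrictI[where coord = "\<lambda>j v. v $ j"])
        (auto simp: vec_eq_iff linked intro!: linearI)
  qed
qed

lemma card_vertices_ge_2:
  assumes "polytope P" "1 \<le> aff_dim P"
  shows "2 \<le> card (vertices P)"
proof -
  have fin: "finite (vertices P)"
    unfolding vertices_def using assms(1) by (intro finite_polyhedron_extreme_points polytope_imp_polyhedron)
  have "P = convex hull (vertices P)"
    unfolding vertices_def using assms(1) by (intro Krein_Milman_Minkowski polytope_imp_compact polytope_imp_convex)
  then have "aff_dim P = aff_dim (vertices P)" by (metis aff_dim_convex_hull)
  also have "\<dots> \<le> int (card (vertices P)) - 1" using fin by (rule aff_dim_le_card)
  finally show ?thesis using assms(2) by linarith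
qed

section \<open>Expansion of half-integral zonotopes\<close>

theorem theorem1p2:
  fixes Z :: "(real ^ 'n) set"
  assumes "zonotope Z"
    and "half_integral Z"
    and "aff_dim Z \<ge> 1"
  shows "polytope_expansion Z \<ge> 7 / 12"
proof -
  obtain p G where gens: "zonotope_generators G" and Z: "Z = zonotope_generators.Z p G"
    using zonotope_imp_generators[OF assms(1)] .
  interpret splitting_generators p G
    using half_integral_imp_splitting_generators gens assms(2) Z by blast
  have "\<forall>B\<in>blocks. \<exists>\<sigma>. signing B \<sigma>" using block_signing by blast
  then obtain \<sigma> where \<sigma>: "\<And>B. B \<in> blocks \<Longrightarrow> signing B (\<sigma> B)" by metis
  define W where "W B = {h \<in> B. 0 < \<sigma> B h}" for B
  have "separable = block_family G blocks W"
    using separable_iff_blocks[of \<sigma> W] \<sigma> by (auto simp: block_family_def W_def)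
  moreover have "log_isoperimetric (7 / 12) (block_family G blocks W) flip"
    using finite_blocks fin disjoint_blocks blocks_subset card_block_ge_3
    by (intro log_isoperimetric_block_family) (auto simp: W_def)
  ultimately have iso: "log_isoperimetric (7 / 12) separable flip" and fin_sep: "finite separable"
    using finite_block_family[OF fin] by simp_all
  have "log_isoperimetric (7 / 12) (vertices Z) {(u, v). {u, v} \<in> graph_edges Z}"
  proof (rule log_isoperimetric_transport[OF iso _ fin_sep])
    show "bij_betw corner separable (vertices Z)"
      unfolding Z vertices_eq using inj_on_corner by (rule inj_on_imp_bij_betw)
    fix x y assume xy: "x \<in> separable" "y \<in> separable" "(x, y) \<in> flip"
    from xy(3) have "{corner x, corner y} \<in> graph_edges Z"
    proof (cases rule: flip_cases)
      case (1 g)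
      then show ?thesis using separable_insert_edge[of x g] xy unfolding Z by simp
    next
      case (2 g)
      then show ?thesis using separable_insert_edge[of y g] xy unfolding Z by (simp add: insert_commute)
    qed
    then show "(corner x, corner y) \<in> {(u, v). {u, v} \<in> graph_edges Z}" by simp
  qed
  moreover have "2 \<le> card (vertices Z)"
    using polytope_Z assms(3) unfolding Z by (rule card_vertices_ge_2)
  ultimately show ?thesis
    unfolding polytope_expansion_def
    by (intro log_isoperimetric_imp_expansion) (auto intro: card_ge_0_finite)
qed

end
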